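(* Let $f_1,f_2\in\mathbb{C}[X_1,X_2]$ be polynomials with positive degree in the variable $X_2$ and with a common zero $\xi=(\xi_1,\xi_2)\in\mathbb{C}^2$. Let $\theta=\sum_{i=0}^N a_i(t-\xi_1)^{\gamma_i}$ with $a_i\in\mathbb{C}$, $a_0=\xi_2$, and let $\gamma_0,\dots,\gamma_N,L\in\mathbb{Q}$ be such that $0=\gamma_0<\dots<\gamma_N\le L$ and $\mathrm{ord}_{(t-\xi_1)}(f_j(t,\theta))>L$ for $j=1,2$. Assume that $f_1(t,\theta)$ and $f_2(t,\theta)$ are not both identically zero. Let $d_{ij}=\deg_{X_i}(f_j)$ for $i,j\in\{1,2\}$. If $L\ge d_{11}d_{22}+d_{12}d_{21}$, then there exists a curve of common zeroes of $f_1$ and $f_2$ that contains $\xi$. Moreover, there is a parametrization of the curve whose initial terms are $\big(t,\sum_{i=0}^{M}a_i(t-\xi_1)^{\gamma_i}\big)$, where $$M=\max\Big\{i\in\{0,\dots,N\}\ \Big|\ \gamma_i\le\frac{L-(d_{11}d_{22}+d_{12}d_{21})-\min\{d_{11},d_{12}\}}{\min\{d_{21},d_{22}\}}+d_{11}+d_{12}\Big\}.$$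
   Context: A Puiseux series with complex coefficients centered at $\xi_1\in\mathbb{C}$ is a formal expression $\sum_{i\in\mathbb{N}_0}a_i(t-\xi_1)^{\gamma_i}$ with $a_i\in\mathbb{C}$ and $\{\gamma_i\}_{i\in\mathbb{N}_0}$ a strictly increasing family of rational numbers with bounded denominators. Its order is $\mathrm{ord}_{(t-\xi_1)}\big(\sum_i a_i(t-\xi_1)^{\gamma_i}\big)=\min\{\gamma_i\mid a_i\neq 0\}$, with the convention that the zero series has order $+\infty$. $\mathbb{C}\{\{t-\xi_1\}\}$ denotes the ring of all such series; $t$ is regarded as the element $\xi_1+(t-\xi_1)$ of it, so $f_j(t,\theta)\in\mathbb{C}\{\{t-\xi_1\}\}$. A parametrization of a plane curve $V(q)\subset\mathbb{C}^2$ through $\xi=(\xi_1,\xi_2)$ is a pair $(t,\eta)$ where $\eta\in\mathbb{C}\{\{t-\xi_1\}\}$ satisfies $q(t,\eta)=0$ and $\eta$ has the form $\xi_2+(\text{terms of positive exponent in } t-\xi_1)$. Its initial terms are $\big(t,\sum_{i=0}^M a_i(t-\xi_1)^{\gamma_i}\big)$ if $\mathrm{ord}_{(t-\xi_1)}\big(\eta-\sum_{i=0}^M a_i(t-\xi_1)^{\gamma_i}\big)>\gamma_M$. *)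

theory Defs
  imports
    Complex_Main
    "HOL-Computational_Algebra.Computational_Algebra"
    "HOL-Library.Extended"
begin

unbundle fps_syntax

section \<open>Formal Puiseux series\<close>

text \<open>
  A Puiseux series is represented by its coefficient function on rational exponents. The centre is
  not part of the type: the formal variable \<open>puiseux_X\<close> below stands for $t - \xi_1$, whatever
  $\xi_1$ is. The function \<open>\<gamma>\<close> enumerates a set of exponents that contains all exponents with
  nonzero coefficient; coefficients at some \<open>\<gamma> i\<close> may vanish.
\<close>

definition is_puiseux :: "(rat \<Rightarrow> 'a::zero) \<Rightarrow> bool" where
  "is_puiseux c \<longleftrightarrow>
     (\<exists>\<gamma> :: nat \<Rightarrow> rat. strict_mono \<gamma> \<and> (\<exists>B. \<forall>i. snd (quotient_of (\<gamma> i)) \<le> B) \<and>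
        {r. c r \<noteq> 0} \<subseteq> range \<gamma>)"

lemma rat_times_fact_Ints:
  assumes "snd (quotient_of r) \<le> B"
  shows "r * of_nat (fact (nat B)) \<in> \<int>"
proof -
  obtain p q where pq: "quotient_of r = (p, q)" by (cases "quotient_of r")
  have q: "q > 0" "r = of_int p / of_int q"
    using pq quotient_of_denom_pos quotient_of_div by auto
  have "nat q dvd fact (nat B)"
    using q assms pq by (intro dvd_fact) auto
  then obtain k where k: "fact (nat B) = nat q * k" by blast
  have "rat_of_nat (fact (nat B)) = of_int q * of_nat k"
    using q(1) by (simp only: k of_nat_mult) simp
  hence "r * of_nat (fact (nat B)) = of_int (p * int k)"
    using q by simp
  thus ?thesis by (metis Ints_of_int)
qed

lemma quotient_of_denom_le:
  assumes "d > 0"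
  shows "snd (quotient_of (of_int k / rat_of_nat d)) \<le> int d"
proof -
  obtain p q where pq: "quotient_of (of_int k / rat_of_nat d) = (p, q)"
    by (cases "quotient_of (of_int k / rat_of_nat d)")
  have q: "q > 0" "coprime p q" "of_int k / rat_of_nat d = of_int p / of_int q"
    using pq quotient_of_denom_pos quotient_of_div quotient_of_coprime by auto
  have "rat_of_int (k * q) = rat_of_int (p * int d)"
    using q assms by (simp add: field_simps)
  hence "k * q = p * int d" by (simp only: of_int_eq_iff)
  hence "q dvd p * int d" by (metis dvd_triv_right)
  hence "q dvd int d" using q(2) by (simp add: coprime_dvd_mult_right_iff coprime_commute)
  thus ?thesis using pq assms by (auto intro: zdvd_imp_le)
qed

text \<open>Every Puiseux series is a Laurent series in a $d$-th root of the variable.\<close>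

definition of_fls_root :: "nat \<Rightarrow> 'a::zero fls \<Rightarrow> rat \<Rightarrow> 'a" where
  "of_fls_root d F = (\<lambda>r. if r * of_nat d \<in> \<int> then F $$ \<lfloor>r * of_nat d\<rfloor> else 0)"

lemma is_puiseux_of_fls_root:
  assumes "d > 0"
  shows "is_puiseux (of_fls_root d F)"
proof -
  define m where "m = fls_subdegree F"
  define \<gamma> where "\<gamma> = (\<lambda>i. of_int (m + int i) / rat_of_nat d)"
  have "strict_mono \<gamma>"
    using assms by (intro strict_monoI) (simp add: \<gamma>_def divide_strict_right_mono)
  moreover have "snd (quotient_of (\<gamma> i)) \<le> int d" for i
    unfolding \<gamma>_def by (rule quotient_of_denom_le[OF assms])
  moreover have "r \<in> range \<gamma>" if "of_fls_root d F r \<noteq> 0" for r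
  proof -
    from that have 1: "r * of_nat d \<in> \<int>" and 2: "F $$ \<lfloor>r * of_nat d\<rfloor> \<noteq> 0"
      by (auto simp: of_fls_root_def split: if_splits)
    from 1 obtain k where k: "r * of_nat d = of_int k" by (elim Ints_cases)
    with 2 have "m \<le> k" by (auto simp: m_def intro: fls_subdegree_leI)
    hence "\<gamma> (nat (k - m)) = r" using k assms by (simp add: \<gamma>_def field_simps)
    thus ?thesis by blast
  qed
  ultimately show ?thesis unfolding is_puiseux_def by blast
qed

lemma is_puiseux_common_denominator:
  assumes "is_puiseux c"
  obtains d m where "d > 0"
    "\<And>r. c r \<noteq> 0 \<Longrightarrow> r * of_nat d \<in> \<int> \<and> of_int m \<le> r"
proof -
  from assms obtain \<gamma> :: "nat \<Rightarrow> rat" and B where \<gamma>: "strict_mono \<gamma>"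
    "\<And>i. snd (quotient_of (\<gamma> i)) \<le> B" "{r. c r \<noteq> 0} \<subseteq> range \<gamma>"
    unfolding is_puiseux_def by blast
  show ?thesis
  proof (rule that[of "fact (nat B)" "\<lfloor>\<gamma> 0\<rfloor>"])
    show "(fact (nat B) :: nat) > 0" by simp
    fix r assume "c r \<noteq> 0"
    then obtain i where r: "r = \<gamma> i" using \<gamma>(3) by blast
    have "\<gamma> 0 \<le> r" using \<gamma>(1) by (simp add: r strict_mono_less_eq)
    with of_int_floor_le[of "\<gamma> 0"] have "of_int \<lfloor>\<gamma> 0\<rfloor> \<le> r" by (rule order.trans)
    thus "r * of_nat (fact (nat B)) \<in> \<int> \<and> of_int \<lfloor>\<gamma> 0\<rfloor> \<le> r"
      using rat_times_fact_Ints[OF \<gamma>(2)[of i]] r by blast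
  qed
qed

lemma ex_of_fls_root:
  assumes "d > 0" "\<And>r. c r \<noteq> 0 \<Longrightarrow> r * of_nat d \<in> \<int> \<and> of_int m \<le> r"
  shows "\<exists>F. c = of_fls_root d F"
proof -
  define f where "f = (\<lambda>k :: int. c (of_int k / of_nat d))"
  have "f k = 0" if "k < m * int d" for k
  proof (rule ccontr)
    assume "f k \<noteq> 0"
    hence "of_int m \<le> of_int k / rat_of_nat d" using assms(2) by (auto simp: f_def)
    hence "rat_of_int (m * int d) \<le> of_int k" using assms(1) by (simp add: field_simps)
    hence "m * int d \<le> k" by (simp only: of_int_le_iff)
    with that show False by simp
  qed
  hence nth: "Abs_fls f $$ k = f k" for k
    by (intro nth_Abs_fls_lower_bound) blast
  have "c r = of_fls_root d (Abs_fls f) r" for r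
  proof (cases "r * of_nat d \<in> \<int>")
    case True
    then obtain k where k: "r * of_nat d = of_int k" by (elim Ints_cases)
    hence "r = of_int k / of_nat d" using assms(1) by (simp add: field_simps)
    thus ?thesis using assms(1) by (simp add: of_fls_root_def nth) (simp add: f_def)
  qed (use assms(2) in \<open>auto simp: of_fls_root_def\<close>)
  thus ?thesis by blast
qed

lemma common_denominator_mult:
  assumes "\<And>r. c r \<noteq> 0 \<Longrightarrow> r * of_nat d \<in> \<int> \<and> of_int m \<le> (r :: rat)"
  shows "c r \<noteq> 0 \<Longrightarrow> r * of_nat (d * e) \<in> \<int> \<and> of_int m \<le> r"
  using assms[of r] by (auto simp flip: mult.assoc)

lemma is_puiseux_triple:
  assumes "is_puiseux a" "is_puiseux b" "is_puiseux c"
  obtains d F G H where "d > 0" "a = of_fls_root d F" "b = of_fls_root d G" "c = of_fls_root d H"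
proof -
  obtain d1 m1 where 1: "d1 > 0" "\<And>r. a r \<noteq> 0 \<Longrightarrow> r * of_nat d1 \<in> \<int> \<and> of_int m1 \<le> r"
    using is_puiseux_common_denominator[OF assms(1)] by blast
  obtain d2 m2 where 2: "d2 > 0" "\<And>r. b r \<noteq> 0 \<Longrightarrow> r * of_nat d2 \<in> \<int> \<and> of_int m2 \<le> r"
    using is_puiseux_common_denominator[OF assms(2)] by blast
  obtain d3 m3 where 3: "d3 > 0" "\<And>r. c r \<noteq> 0 \<Longrightarrow> r * of_nat d3 \<in> \<int> \<and> of_int m3 \<le> r"
    using is_puiseux_common_denominator[OF assms(3)] by blast
  define d where "d = d1 * d2 * d3"
  have d: "d > 0" "d = d1 * (d2 * d3)" "d = d2 * (d1 * d3)" "d = d3 * (d1 * d2)"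
    using 1 2 3 by (auto simp: d_def)
  have "\<exists>F. a = of_fls_root d F"
    by (rule ex_of_fls_root[OF d(1)], subst d(2)) (rule common_denominator_mult[OF 1(2)])
  moreover have "\<exists>F. b = of_fls_root d F"
    by (rule ex_of_fls_root[OF d(1)], subst d(3)) (rule common_denominator_mult[OF 2(2)])
  moreover have "\<exists>F. c = of_fls_root d F"
    by (rule ex_of_fls_root[OF d(1)], subst d(4)) (rule common_denominator_mult[OF 3(2)])
  ultimately show ?thesis using that d(1) by blast
qed

lemma of_fls_root_0: "of_fls_root d 0 = (\<lambda>_. 0)"
  by (auto simp: of_fls_root_def)

lemma of_fls_root_add:
  "of_fls_root d (F + G) = (\<lambda>r. of_fls_root d F r + of_fls_root d (G :: 'a::monoid_add fls) r)"
  by (auto simp: of_fls_root_def)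

lemma of_fls_root_uminus:
  "of_fls_root d (- F) = (\<lambda>r. - of_fls_root d (F :: 'a::group_add fls) r)"
  by (auto simp: of_fls_root_def)

lemma of_fls_root_monom:
  assumes "d > 0"
  shows "of_fls_root d (fls_shift (- k) (fls_const a)) =
    (\<lambda>r. if r = of_int k / of_nat d then a else 0)"
proof
  fix r :: rat
  show "of_fls_root d (fls_shift (- k) (fls_const a)) r = (if r = of_int k / of_nat d then a else 0)"
  proof (cases "r * of_nat d \<in> \<int>")
    case True
    then obtain j where "r * of_nat d = of_int j" by (elim Ints_cases)
    thus ?thesis using assms by (auto simp: of_fls_root_def field_simps)
  next
    case False
    hence "r \<noteq> of_int k / of_nat d" using assms by auto
    with False show ?thesis by (simp add: of_fls_root_def)
  qed
qed

definition puiseux_conv :: "(rat \<Rightarrow> 'a::comm_ring_1) \<Rightarrow> (rat \<Rightarrow> 'a) \<Rightarrow> rat \<Rightarrow> 'a" where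
  "puiseux_conv a b r = (\<Sum>s | a s \<noteq> 0 \<and> b (r - s) \<noteq> 0. a s * b (r - s))"

lemma puiseux_conv_of_fls_root:
  assumes "d > 0"
  shows "puiseux_conv (of_fls_root d F) (of_fls_root d G) = of_fls_root d (F * G)"
proof
  fix r :: rat
  let ?a = "of_fls_root d F" and ?b = "of_fls_root d G"
  let ?S = "{s. ?a s \<noteq> 0 \<and> ?b (r - s) \<noteq> 0}"
  show "puiseux_conv ?a ?b r = of_fls_root d (F * G) r"
  proof (cases "r * of_nat d \<in> \<int>")
    case False
    have "?S = {}"
    proof (rule equals0I)
      fix s assume "s \<in> ?S"
      hence "s * of_nat d \<in> \<int>" "(r - s) * of_nat d \<in> \<int>"
        by (auto simp: of_fls_root_def split: if_splits)
      from Ints_add[OF this] False show False by (simp add: algebra_simps)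
    qed
    thus ?thesis unfolding puiseux_conv_def using False by (simp only: sum.empty) (simp add: of_fls_root_def)
  next
    case True
    then obtain k where k: "r * of_nat d = of_int k" by (elim Ints_cases)
    define I where "I = {fls_subdegree F..k - fls_subdegree G}"
    define h where "h = (\<lambda>i :: int. of_int i / rat_of_nat d)"
    have a: "?a (h i) = F $$ i" for i
      using assms by (simp add: of_fls_root_def h_def)
    have b: "?b (r - h i) = G $$ (k - i)" for i
    proof -
      have "(r - h i) * of_nat d = of_int (k - i)"
        using assms k by (simp add: h_def left_diff_distrib)
      thus ?thesis by (simp add: of_fls_root_def)
    qed
    have inj: "inj_on h I" using assms by (auto simp: inj_on_def h_def)
    have sub: "?S \<subseteq> h ` I"
    proof
      fix s assume s: "s \<in> ?S"
      hence "s * of_nat d \<in> \<int>" by (auto simp: of_fls_root_def split: if_splits)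
      then obtain i where "s * of_nat d = of_int i" by (elim Ints_cases)
      hence i: "s = h i" using assms by (simp add: h_def field_simps)
      from s have "F $$ i \<noteq> 0" "G $$ (k - i) \<noteq> 0" by (auto simp: i a b)
      hence "fls_subdegree F \<le> i" "fls_subdegree G \<le> k - i"
        by (auto intro: fls_subdegree_leI)
      thus "s \<in> h ` I" by (auto simp: i I_def)
    qed
    have "puiseux_conv ?a ?b r = (\<Sum>s\<in>h ` I. ?a s * ?b (r - s))"
      unfolding puiseux_conv_def
      using sub by (intro sum.mono_neutral_left) (auto simp: I_def)
    also have "\<dots> = (\<Sum>i\<in>I. F $$ i * G $$ (k - i))"
      by (simp add: sum.reindex[OF inj] a b)
    also have "\<dots> = of_fls_root d (F * G) r"
      using k by (simp add: of_fls_root_def fls_times_nth(2) I_def)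
    finally show ?thesis .
  qed
qed

typedef (overloaded) 'a puiseux = "{c :: rat \<Rightarrow> 'a::zero. is_puiseux c}"
  morphisms puiseux_nth Abs_puiseux
  using is_puiseux_of_fls_root[of 1] by auto

setup_lifting type_definition_puiseux

lift_definition puiseux_monom :: "'a::zero \<Rightarrow> rat \<Rightarrow> 'a puiseux" is
  "\<lambda>a s r. if r = s then a else 0"
proof -
  fix a :: 'a and s :: rat
  obtain p q where pq: "quotient_of s = (p, q)" by (cases "quotient_of s")
  have "q > 0" "s = of_int p / of_int q"
    using pq quotient_of_denom_pos quotient_of_div by auto
  hence q: "nat q > 0" "s = of_int p / of_nat (nat q)" by auto
  show "is_puiseux (\<lambda>r. if r = s then a else 0)"
    using is_puiseux_of_fls_root[OF q(1), of "fls_shift (- p) (fls_const a)"]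
    by (simp only: of_fls_root_monom[OF q(1)] q(2))
qed

abbreviation puiseux_const :: "'a::zero \<Rightarrow> 'a puiseux" where
  "puiseux_const a \<equiv> puiseux_monom a 0"

abbreviation puiseux_X :: "'a::zero_neq_one puiseux" where
  "puiseux_X \<equiv> puiseux_monom 1 1"

instantiation puiseux :: (comm_ring_1) comm_ring_1
begin

lift_definition zero_puiseux :: "'a puiseux" is "\<lambda>_. 0"
  using is_puiseux_of_fls_root[of 1 0] by (simp add: of_fls_root_0)

lift_definition one_puiseux :: "'a puiseux" is "\<lambda>r. if r = 0 then 1 else 0"
  using is_puiseux_of_fls_root[of 1 "fls_shift (- 0) (fls_const 1)"]
  by (simp only: of_fls_root_monom) simp

lift_definition plus_puiseux :: "'a puiseux \<Rightarrow> 'a puiseux \<Rightarrow> 'a puiseux" is "\<lambda>a b r. a r + b r"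
proof -
  fix a b :: "rat \<Rightarrow> 'a" assume ab: "is_puiseux a" "is_puiseux b"
  show "is_puiseux (\<lambda>r. a r + b r)"
    by (rule is_puiseux_triple[OF ab(1) ab(2) ab(2)]) (simp_all add: is_puiseux_of_fls_root flip: of_fls_root_add)
qed

lift_definition uminus_puiseux :: "'a puiseux \<Rightarrow> 'a puiseux" is "\<lambda>a r. - a r"
proof -
  fix a :: "rat \<Rightarrow> 'a" assume a: "is_puiseux a"
  show "is_puiseux (\<lambda>r. - a r)"
    by (rule is_puiseux_triple[OF a a a]) (simp_all add: is_puiseux_of_fls_root flip: of_fls_root_uminus)
qed

definition minus_puiseux :: "'a puiseux \<Rightarrow> 'a puiseux \<Rightarrow> 'a puiseux" where
  "minus_puiseux a b = a + - b"

lift_definition times_puiseux :: "'a puiseux \<Rightarrow> 'a puiseux \<Rightarrow> 'a puiseux" is puiseux_conv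
proof -
  fix a b :: "rat \<Rightarrow> 'a" assume ab: "is_puiseux a" "is_puiseux b"
  show "is_puiseux (puiseux_conv a b)"
    by (rule is_puiseux_triple[OF ab(1) ab(2) ab(2)]) (simp_all add: is_puiseux_of_fls_root puiseux_conv_of_fls_root)
qed

instance
proof
  fix a b c :: "'a puiseux"
  show "a + b + c = a + (b + c)" by transfer (simp add: add.assoc)
  show "a + b = b + a" by transfer (simp add: add.commute)
  show "0 + a = a" by transfer simp
  show "- a + a = 0" by transfer simp
  show "a - b = a + - b" by (simp add: minus_puiseux_def)
  show "a * b * c = a * (b * c)"
  proof transfer
    fix a b c :: "rat \<Rightarrow> 'a" assume "is_puiseux a" "is_puiseux b" "is_puiseux c"
    then show "puiseux_conv (puiseux_conv a b) c = puiseux_conv a (puiseux_conv b c)"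
      by (rule is_puiseux_triple) (simp add: puiseux_conv_of_fls_root mult.assoc)
  qed
  show "a * b = b * a"
  proof transfer
    fix a b :: "rat \<Rightarrow> 'a" assume ab: "is_puiseux a" "is_puiseux b"
    show "puiseux_conv a b = puiseux_conv b a"
      by (rule is_puiseux_triple[OF ab(1) ab(2) ab(2)]) (simp_all add: puiseux_conv_of_fls_root mult.commute)
  qed
  show "1 * a = a"
  proof transfer
    fix a :: "rat \<Rightarrow> 'a" assume "is_puiseux a"
    then obtain d F where d: "d > 0" "a = of_fls_root d F"
      using is_puiseux_triple[of a a a] by blast
    have "(\<lambda>r :: rat. if r = 0 then 1 else 0) = of_fls_root d (1 :: 'a fls)"
      using of_fls_root_monom[OF d(1), of 0 "1 :: 'a"] by simp
    thus "puiseux_conv (\<lambda>r. if r = 0 then 1 else 0) a = a"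
      using d by (simp add: puiseux_conv_of_fls_root)
  qed
  show "(a + b) * c = a * c + b * c"
  proof transfer
    fix a b c :: "rat \<Rightarrow> 'a" assume "is_puiseux a" "is_puiseux b" "is_puiseux c"
    then obtain d F G H where d: "d > 0"
      "a = of_fls_root d F" "b = of_fls_root d G" "c = of_fls_root d H"
      using is_puiseux_triple[of a b c] by blast
    thus "puiseux_conv (\<lambda>r. a r + b r) c = (\<lambda>r. puiseux_conv a c r + puiseux_conv b c r)"
      by (simp add: puiseux_conv_of_fls_root distrib_right flip: of_fls_root_add)
  qed
  show "(0 :: 'a puiseux) \<noteq> 1" by transfer (auto dest: fun_cong[of _ _ 0])
qed

end

definition puiseux_ord :: "'a::comm_ring_1 puiseux \<Rightarrow> rat extended" where
  "puiseux_ord f = (if f = 0 then Pinf else Fin (LEAST r. puiseux_nth f r \<noteq> 0))"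

text \<open>The minimum in the definition of the order is attained.\<close>

lemma puiseux_ord_nonzero:
  assumes "f \<noteq> 0"
  obtains r where "puiseux_ord f = Fin r" "puiseux_nth f r \<noteq> 0"
    "\<And>s. puiseux_nth f s \<noteq> 0 \<Longrightarrow> r \<le> s"
proof -
  from assms obtain s0 where s0: "puiseux_nth f s0 \<noteq> 0" by transfer auto
  have "is_puiseux (puiseux_nth f)" using puiseux_nth[of f] by simp
  then obtain \<gamma> :: "nat \<Rightarrow> rat" where \<gamma>: "strict_mono \<gamma>" "{r. puiseux_nth f r \<noteq> 0} \<subseteq> range \<gamma>"
    unfolding is_puiseux_def by blast
  define i where "i = (LEAST i. puiseux_nth f (\<gamma> i) \<noteq> 0)"
  from s0 \<gamma>(2) have "\<exists>i. puiseux_nth f (\<gamma> i) \<noteq> 0" by blast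
  hence i: "puiseux_nth f (\<gamma> i) \<noteq> 0" unfolding i_def by (rule LeastI_ex)
  have le: "\<gamma> i \<le> s" if s: "puiseux_nth f s \<noteq> 0" for s
  proof -
    from s \<gamma>(2) obtain j where j: "s = \<gamma> j" by blast
    have "i \<le> j" unfolding i_def by (rule Least_le) (use s j in simp)
    thus ?thesis using \<gamma>(1) by (simp add: j strict_mono_less_eq)
  qed
  have "(LEAST r. puiseux_nth f r \<noteq> 0) = \<gamma> i" using i le by (rule Least_equality)
  thus ?thesis using that[of "\<gamma> i"] i le assms by (simp add: puiseux_ord_def)
qed


unbundle no fps_syntax

section \<open>Bivariate polynomials and plane curves\<close>

text \<open>
  An element \<open>f\<close> of \<open>complex poly poly\<close> represents a polynomial in $\mathbb{C}[X_1,X_2] =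
  \mathbb{C}[X_1][X_2]$: the outer variable is $X_2$, and the coefficients are polynomials in $X_1$.
\<close>

definition deg_X1 :: "'a::zero poly poly \<Rightarrow> nat" where
  "deg_X1 f = (MAX i\<in>{..degree f}. degree (coeff f i))"

abbreviation deg_X2 :: "'a::zero poly poly \<Rightarrow> nat" where
  "deg_X2 f \<equiv> degree f"

definition eval2 :: "'a::comm_semiring_0 poly poly \<Rightarrow> 'a \<Rightarrow> 'a \<Rightarrow> 'a" where
  "eval2 f x1 x2 = poly (map_poly (\<lambda>c. poly c x1) f) x2"

text \<open>
  The substitution $f(t,\eta)$, computed in the ring of Puiseux series centred at $\xi_1$, where
  $t = \xi_1 + (t - \xi_1)$.
\<close>

definition puiseux_subst :: "complex poly poly \<Rightarrow> complex \<Rightarrow> complex puiseux \<Rightarrow> complex puiseux" where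
  "puiseux_subst f \<xi>1 \<eta> =
     eval2 (map_poly (map_poly puiseux_const) f) (puiseux_const \<xi>1 + puiseux_X) \<eta>"

definition zero_locus :: "complex poly poly \<Rightarrow> (complex \<times> complex) set" where
  "zero_locus q = {(x1, x2). eval2 q x1 x2 = 0}"

definition nonconstant :: "complex poly poly \<Rightarrow> bool" where
  "nonconstant q \<longleftrightarrow> deg_X1 q > 0 \<or> deg_X2 q > 0"

text \<open>
  \<open>(t, \<eta>)\<close> is a parametrization of $V(q)$ through $(\xi_1,\xi_2)$; only the second component is
  recorded.
\<close>

definition parametrizes :: "complex puiseux \<Rightarrow> complex poly poly \<Rightarrow> complex \<times> complex \<Rightarrow> bool" where
  "parametrizes \<eta> q \<xi> \<longleftrightarrow>
     puiseux_subst q (fst \<xi>) \<eta> = 0 \<and>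
     (\<forall>r. puiseux_nth (\<eta> - puiseux_const (snd \<xi>)) r \<noteq> 0 \<longrightarrow> r > 0)"

definition puiseux_partial :: "(nat \<Rightarrow> complex) \<Rightarrow> (nat \<Rightarrow> rat) \<Rightarrow> nat \<Rightarrow> complex puiseux" where
  "puiseux_partial a \<gamma> M = (\<Sum>i=0..M. puiseux_monom (a i) (\<gamma> i))"

definition has_initial_terms ::
    "complex puiseux \<Rightarrow> (nat \<Rightarrow> complex) \<Rightarrow> (nat \<Rightarrow> rat) \<Rightarrow> nat \<Rightarrow> bool" where
  "has_initial_terms \<eta> a \<gamma> M \<longleftrightarrow> puiseux_ord (\<eta> - puiseux_partial a \<gamma> M) > Fin (\<gamma> M)"

end

theory Submission
  imports Defs "Subresultants.Subresultant_Gcd" "HOL-Computational_Algebra.Field_as_Ring"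
begin

text \<open>
  Put \<open>g = gcd f1 f2\<close> and \<open>f\<^sub>j = h\<^sub>j * g\<close>. The cofactors are coprime, so their resultant with respect
  to $X_2$ is a nonzero $r \in \mathbb{C}[t]$ of the form $A h_1 + B h_2$, and its degree is at most
  \<open>D' = deg_X1 h1 * degree h2 + deg_X1 h2 * degree h1\<close> (\<open>coprime_imp_eliminant\<close>). A nonzero polynomial
  cannot vanish at $\xi_1$ to an order above its degree, so one of the $h_j(t,\theta)$ has order at
  most $D'$. As $f_j(t,\theta)$ has order above $L$, the order of $g(t,\theta)$ is above $L - D'$.

  By the theorem of Newton and Puiseux, $g(t,X_2) = c \prod_k (X_2 - \eta_k)$ over the Puiseux series,
  where $c$ is the leading coefficient of $g$. Thus the order of $g(t,\theta)$ is the sum of that of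
  $c$, which is at most $\deg_{X_1} g$, and of those of the $\theta - \eta_k$. Their number is
  $\deg_{X_2} g$, so some root satisfies
  \[ \mathrm{ord}(\theta - \eta) > \frac{L - D' - \deg_{X_1} g}{\deg_{X_2} g} , \]
  and \<open>exponent_bound\<close> shows that the right-hand side is at least the number in the definition of $M$.
  The hypothesis on $L$ makes $L - D'$ at least $\deg_{X_1} g$, which forces $\deg_{X_2} g > 0$. So
  $V(g)$ is the curve, \<open>(t, \<eta>)\<close> is its parametrization, and evaluating $g(t,\eta) = 0$ at $\xi_1$
  shows that it passes through $\xi$.

  Every Puiseux series that occurs is a power series in some $s$ with $s^d = t - \xi_1$. The order
  estimates and the theorem of Newton and Puiseux are therefore carried out in
  $\mathbb{C}[[s]]$, where orders are natural numbers (\<open>subdegree\<close>); enlarging $d$ to $de$ is the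
  substitution $s \mapsto s^e$, called \<open>ramify e\<close>. Only the last part translates the result by the
  injective ring homomorphisms \<open>puiseux_of_fps d\<close> that send $s$ to $(t-\xi_1)^{1/d}$.
\<close>

hide_const (open) Module.smult

section \<open>Bidegrees and elimination of the second variable\<close>

lemma degree_coeff_le_deg_X1: "degree (coeff f i) \<le> deg_X1 f"
proof (cases "i \<le> degree f")
  case True
  thus ?thesis unfolding deg_X1_def by (intro Max_ge) auto
qed (simp add: coeff_eq_0)

lemma deg_X1_attained: "\<exists>i\<le>degree f. degree (coeff f i) = deg_X1 f"
proof -
  have "deg_X1 f \<in> (\<lambda>i. degree (coeff f i)) ` {..degree f}"
    unfolding deg_X1_def by (intro Max_in) auto
  thus ?thesis by auto
qed

lemma coeff_mult_at_degree_bounds: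
  fixes p q :: "'a::comm_semiring_0 poly"
  assumes "degree p \<le> m" "degree q \<le> n"
  shows "coeff (p * q) (m + n) = coeff p m * coeff q n"
proof -
  have "coeff (p * q) (m + n) = (\<Sum>i\<le>m + n. coeff p i * coeff q (m + n - i))"
    by (simp add: coeff_mult)
  also have "\<dots> = (\<Sum>i\<in>{m}. coeff p i * coeff q (m + n - i))"
  proof (rule sum.mono_neutral_right)
    show "\<forall>i\<in>{..m + n} - {m}. coeff p i * coeff q (m + n - i) = 0"
    proof
      fix i assume i: "i \<in> {..m + n} - {m}"
      show "coeff p i * coeff q (m + n - i) = 0"
        using i assms by (cases "i < m") (auto simp: coeff_eq_0)
    qed
  qed auto
  finally show ?thesis by simp
qed

text \<open>
  The coefficients of $X_1^{\deg_{X_1} f}$ in \<open>f\<close> and of $X_1^{\deg_{X_1} g}$ in \<open>g\<close> are nonzero polynomials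
  in $X_2$. Their product is the coefficient of $X_1^{\deg_{X_1} f + \deg_{X_1} g}$ in \<open>f * g\<close>, and it
  does not vanish over a domain.
\<close>

lemma deg_X1_mult_ge:
  fixes f g :: "'a::idom poly poly"
  assumes "f \<noteq> 0" "g \<noteq> 0"
  shows "deg_X1 f + deg_X1 g \<le> deg_X1 (f * g)"
proof -
  define top where "top = (\<lambda>h :: 'a poly poly. map_poly (\<lambda>c. coeff c (deg_X1 h)) h)"
  have coeff_top: "coeff (top h) i = coeff (coeff h i) (deg_X1 h)" for h i
    by (simp add: top_def coeff_map_poly)
  have top_nonzero: "top h \<noteq> 0" if "h \<noteq> 0" for h
  proof -
    have "\<exists>i. coeff (coeff h i) (deg_X1 h) \<noteq> 0"
    proof (cases "deg_X1 h = 0")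
      case True
      hence "degree (lead_coeff h) = 0" using degree_coeff_le_deg_X1[of h "degree h"] by simp
      hence "coeff (lead_coeff h) 0 \<noteq> 0" using that by (metis leading_coeff_0_iff)
      thus ?thesis using True by auto
    next
      case False
      obtain i where "degree (coeff h i) = deg_X1 h" using deg_X1_attained by blast
      thus ?thesis using False by (metis degree_0 leading_coeff_0_iff)
    qed
    then obtain i where "coeff (top h) i \<noteq> 0" by (auto simp: coeff_top)
    thus ?thesis by auto
  qed
  have "top f * top g \<noteq> 0" using top_nonzero assms by simp
  then obtain m where m: "coeff (top f * top g) m \<noteq> 0" by (metis leading_coeff_0_iff)
  have "coeff (coeff (f * g) m) (deg_X1 f + deg_X1 g) =
      (\<Sum>i\<le>m. coeff (coeff f i * coeff g (m - i)) (deg_X1 f + deg_X1 g))"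
    by (simp add: coeff_mult coeff_sum)
  also have "\<dots> = coeff (top f * top g) m"
    by (simp add: coeff_mult[of "top f"] coeff_top coeff_mult_at_degree_bounds degree_coeff_le_deg_X1)
  finally have "deg_X1 f + deg_X1 g \<le> degree (coeff (f * g) m)"
    using m by (intro le_degree) simp
  thus ?thesis using degree_coeff_le_deg_X1[of "f * g" m] by linarith
qed

text \<open>
  In the Leibniz expansion of the Sylvester determinant, every product takes \<open>degree g\<close> factors among
  the coefficients of \<open>f\<close> and \<open>degree f\<close> factors among those of \<open>g\<close>.
\<close>

lemma degree_resultant_le:
  fixes f g :: "'a::idom poly poly"
  shows "degree (resultant f g) \<le> deg_X1 f * degree g + deg_X1 g * degree f"
proof -
  define m n where "m = degree f" and "n = degree g"
  define S where "S = sylvester_mat f g"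
  have "degree (signof p * (\<Prod>i=0..<m + n. S $$ (i, p i))) \<le> deg_X1 f * n + deg_X1 g * m"
    if p: "p permutes {0..<m + n}" for p
  proof -
    have entry: "degree (S $$ (i, p i)) \<le> (if i < n then deg_X1 f else deg_X1 g)"
      if i: "i \<in> {0..<m + n}" for i
    proof -
      have "i < m + n" "p i < m + n" using i permutes_in_image[OF p, of i] by auto
      thus ?thesis
        unfolding S_def m_def n_def by (subst sylvester_index_mat) (auto simp: degree_coeff_le_deg_X1)
    qed
    have "degree (signof p * (\<Prod>i=0..<m + n. S $$ (i, p i))) \<le>
        degree (signof p :: 'a poly) + degree (\<Prod>i=0..<m + n. S $$ (i, p i))"
      by (rule degree_mult_le)
    also have "degree (signof p :: 'a poly) = 0" by (simp add: sign_def)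
    also have "degree (\<Prod>i=0..<m + n. S $$ (i, p i)) \<le> (\<Sum>i=0..<m + n. degree (S $$ (i, p i)))"
      using degree_prod_sum_le[of "{0..<m + n}" "\<lambda>i. S $$ (i, p i)"] by (simp add: o_def)
    also have "\<dots> \<le> (\<Sum>i=0..<m + n. if i < n then deg_X1 f else deg_X1 g)"
      by (rule sum_mono) (rule entry)
    also have "\<dots> = (\<Sum>i=0..<n. if i < n then deg_X1 f else deg_X1 g) +
                   (\<Sum>i=n..<m + n. if i < n then deg_X1 f else deg_X1 g)"
      by (rule sum.atLeastLessThan_concat[symmetric]) auto
    also have "\<dots> = deg_X1 f * n + deg_X1 g * m" by simp
    finally show ?thesis by simp
  qed
  moreover have "resultant f g = (\<Sum>p | p permutes {0..<m + n}. signof p * (\<Prod>i=0..<m + n. S $$ (i, p i)))"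
    unfolding resultant_def S_def m_def n_def by (rule det_def'[OF sylvester_carrier_mat])
  ultimately show ?thesis
    unfolding m_def[symmetric] n_def[symmetric] by (auto intro: degree_sum_le finite_permutations)
qed

text \<open>
  The subresultant of index 0 is the constant polynomial \<open>resultant f g\<close>. It is the determinant of
  a matrix whose last row consists of multiples of \<open>f\<close> and \<open>g\<close>, and Laplace expansion along that row
  gives the combination. If both degrees are 0, the matrix is empty and the resultant is 1, which
  need not be in the ideal.
\<close>

lemma resultant_eq_combination:
  fixes f g :: "'a::idom poly"
  assumes "degree f + degree g > 0"
  shows "\<exists>A B. [:resultant f g:] = A * f + B * g"
proof -
  define n where "n = degree f + degree g"
  define M where "M = subresultant_mat 0 f g"
  have M: "M \<in> carrier_mat n n"
    by (rule carrier_matI) (simp_all add: M_def n_def)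
  have n: "n > 0" using assms by (simp add: n_def)
  have "\<exists>A B. M $$ (n - 1, j) = A * f + B * g" if "j < n" for j
  proof (cases "j < degree g")
    case True
    hence "M $$ (n - 1, j) = monom 1 (degree g - 1 - j) * f + 0 * g"
      unfolding M_def using that n by (subst subresultant_index_mat) (auto simp: n_def)
    thus ?thesis by blast
  next
    case False
    hence "M $$ (n - 1, j) = 0 * f + monom 1 (degree f - 1 - (j - degree g)) * g"
      unfolding M_def using that n by (subst subresultant_index_mat) (auto simp: n_def Let_def)
    thus ?thesis by blast
  qed
  then obtain A B where AB: "\<And>j. j < n \<Longrightarrow> M $$ (n - 1, j) = A j * f + B j * g" by metis
  have "[:resultant f g:] = det M"
    by (simp add: M_def subresultant_def flip: subresultant_resultant)
  also have "\<dots> = (\<Sum>j<n. M $$ (n - 1, j) * cofactor M (n - 1) j)"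
    using n by (intro laplace_expansion_row[OF M]) simp
  also have "\<dots> = (\<Sum>j<n. A j * cofactor M (n - 1) j * f + B j * cofactor M (n - 1) j * g)"
  proof (rule sum.cong)
    fix j assume "j \<in> {..<n}"
    hence AB': "M $$ (n - 1, j) = A j * f + B j * g" by (intro AB) simp
    have "(A j * f + B j * g) * c = A j * c * f + B j * c * g" for c
      by (simp add: algebra_simps)
    thus "M $$ (n - 1, j) * cofactor M (n - 1) j =
        A j * cofactor M (n - 1) j * f + B j * cofactor M (n - 1) j * g"
      unfolding AB' .
  qed simp
  also have "\<dots> = (\<Sum>j<n. A j * cofactor M (n - 1) j) * f + (\<Sum>j<n. B j * cofactor M (n - 1) j) * g"
    by (simp add: sum.distrib sum_distrib_right)
  finally show ?thesis by blast
qed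

text \<open>
  The resultant serves as \<open>r\<close>, except when both polynomials are constant in $X_2$: then the bound on the
  degree is 0, and Bezout's identity in $\mathbb{C}[X_1]$ provides \<open>r = 1\<close>.
\<close>

lemma coprime_imp_eliminant:
  fixes f g :: "complex poly poly"
  assumes cop: "coprime f g"
  obtains r A B where "r \<noteq> 0" "degree r \<le> deg_X1 f * degree g + deg_X1 g * degree f"
    "[:r:] = A * f + B * g"
proof (cases "degree f + degree g > 0")
  case True
  have "resultant f g \<noteq> 0" using cop by (simp add: resultant_0_gcd)
  with that[OF _ degree_resultant_le] resultant_eq_combination[OF True] show ?thesis by blast
next
  case False
  then obtain a b where fg: "f = [:a:]" "g = [:b:]"
    by (metis add_gr_0 degree_eq_zeroE gr0I)
  have "coprime a b"
  proof (rule coprimeI)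
    fix c assume "c dvd a" "c dvd b"
    hence "[:c:] dvd f" "[:c:] dvd g" by (simp_all add: fg const_poly_dvd_const_poly_iff)
    with cop have "is_unit [:c:]" by (rule coprime_common_divisor)
    thus "is_unit c" by (simp add: is_unit_const_poly_iff)
  qed
  hence "fst (bezout_coefficients a b) * a + snd (bezout_coefficients a b) * b = 1"
    by (simp add: bezout_coefficients_fst_snd)
  hence "[:1:] = [:fst (bezout_coefficients a b):] * f + [:snd (bezout_coefficients a b):] * g"
    by (simp add: fg mult.commute)
  from that[OF _ _ this] show ?thesis by simp
qed

unbundle fps_syntax
no_notation vec_index (infixl "$" 100) and index_mat (infixl "$$" 100)

section \<open>Hensel lifting over power series\<close>

text \<open>
  The inclusion of $A[[s]][X]$ into $A[X][[s]]$. Hensel lifting proceeds by powers of $s$, so it takes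
  place on the right-hand side.
\<close>

definition fps_transpose :: "'a::zero fps poly \<Rightarrow> 'a poly fps" where
  "fps_transpose P = Abs_fps (\<lambda>k. map_poly (\<lambda>f. f $ k) P)"

lemma coeff_fps_transpose [simp]: "coeff (fps_transpose P $ k) i = coeff P i $ k"
  by (simp add: fps_transpose_def coeff_map_poly)

lemma fps_transpose_mult:
  fixes P Q :: "'a::comm_ring_1 fps poly"
  shows "fps_transpose (P * Q) = fps_transpose P * fps_transpose Q"
proof (rule fps_ext, rule poly_eqI)
  fix k i
  have "coeff (fps_transpose (P * Q) $ k) i =
      (\<Sum>l\<le>i. \<Sum>j=0..k. coeff P l $ j * coeff Q (i - l) $ (k - j))"
    by (simp add: coeff_mult fps_sum_nth fps_mult_nth)
  also have "\<dots> = coeff ((fps_transpose P * fps_transpose Q) $ k) i"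
    by (subst sum.swap) (simp add: fps_mult_nth coeff_sum coeff_mult)
  finally show "coeff (fps_transpose (P * Q) $ k) i = coeff ((fps_transpose P * fps_transpose Q) $ k) i" .
qed

lemma fps_transpose_eq_iff: "fps_transpose P = fps_transpose Q \<longleftrightarrow> P = Q"
proof
  assume eq: "fps_transpose P = fps_transpose Q"
  show "P = Q"
    by (intro poly_eqI fps_ext) (metis eq coeff_fps_transpose)
qed auto

text \<open>
  The image consists of the series whose coefficients are polynomials of bounded degree.
\<close>

lemma ex_fps_transpose:
  fixes G :: "'a::comm_ring_1 poly fps"
  assumes "\<And>k. degree (G $ k) \<le> m"
  shows "\<exists>P. degree P \<le> m \<and> fps_transpose P = G"
proof -
  define P where "P = (\<Sum>i\<le>m. monom (Abs_fps (\<lambda>k. coeff (G $ k) i)) i)"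
  have c: "coeff P i = (if i \<le> m then Abs_fps (\<lambda>k. coeff (G $ k) i) else 0)" for i
    by (simp add: P_def coeff_sum sum.delta)
  have "coeff (G $ k) i = 0" if "i > m" for i k
    using assms[of k] that by (simp add: coeff_eq_0)
  hence "fps_transpose P = G"
    by (intro fps_ext poly_eqI) (auto simp: c)
  moreover have "degree P \<le> m" by (rule degree_le) (auto simp: c)
  ultimately show ?thesis by blast
qed

text \<open>
  The step of Hensel lifting: the linear equation for the next coefficients of the two factors. From
  any solution by Bezout's identity, reducing \<open>u\<close> modulo \<open>g\<close> gives one in which \<open>u\<close> has small degree, and
  comparing degrees in the equation bounds \<open>v\<close> as well.
\<close>

lemma coprime_poly_combination:
  fixes g h R :: "complex poly"
  assumes "coprime g h" "degree g > 0" "degree h > 0" "degree R < degree g + degree h"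
  shows "\<exists>u v. g * v + u * h = R \<and> degree u < degree g \<and> degree v < degree h"
proof -
  obtain a b where ab: "a * g + b * h = 1"
    using assms(1) bezout_coefficients_fst_snd[of g h]
    by (intro that[of "fst (bezout_coefficients g h)" "snd (bezout_coefficients g h)"]) simp
  define u where "u = (b * R) mod g"
  define v where "v = a * R + (b * R div g) * h"
  have "g * v + u * h = a * g * R + ((b * R div g) * g + u) * h"
    by (simp add: v_def algebra_simps)
  also have "(b * R div g) * g + u = b * R" by (simp add: u_def)
  also have "a * g * R + b * R * h = (a * g + b * h) * R" by (simp add: algebra_simps)
  finally have eq: "g * v + u * h = R" by (simp add: ab)
  have u: "degree u < degree g"
    using assms(2) degree_mod_less'[of g "b * R"] by (cases "u = 0") (force simp: u_def)+
  have "degree v < degree h"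
  proof (cases "v = 0")
    case False
    have "g * v = R - u * h" using eq by (simp add: algebra_simps)
    moreover have "degree (R - u * h) < degree g + degree h"
    proof (rule degree_diff_less)
      show "degree (u * h) < degree g + degree h"
        using u degree_mult_le[of u h] by linarith
    qed (use assms in auto)
    moreover have "degree (g * v) = degree g + degree v"
      using False assms(2) by (intro degree_mult_eq) auto
    ultimately show ?thesis by simp
  qed (use assms in auto)
  with u eq show ?thesis by blast
qed

text \<open>
  The pairs of coefficients of $s^k$ in the two lifted factors. For $k > 0$ the equation between the
  coefficients of $s^k$ reads $g_0 h_k + g_k h_0 = F_k - \sum_{0<i<k} g_i h_{k-i}$. Here \<open>S\<close>
  solves it for $(g_k, h_k)$, and \<open>gh\<close> is the given factorization $(g_0, h_0)$.
\<close>

fun hensel_seq :: "(nat \<Rightarrow> 'a) \<Rightarrow> ('a \<Rightarrow> 'a \<times> 'a) \<Rightarrow> 'a \<times> 'a \<Rightarrow> nat \<Rightarrow> 'a::comm_ring_1 \<times> 'a" where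
  "hensel_seq F S gh k = (if k = 0 then gh else
     S (F k - (\<Sum>i\<in>{1..<k}. fst (hensel_seq F S gh i) * snd (hensel_seq F S gh (k - i)))))"

declare hensel_seq.simps [simp del]

text \<open>
  Hensel's lemma. All corrections in degree $k > 0$ in $s$ have smaller degree in $X$ than the given
  factors, so the lifted factors are again monic polynomials of the same degrees.
\<close>

lemma hensel_fps:
  fixes F :: "complex fps poly"
  assumes F: "lead_coeff F = 1" and red: "map_poly (\<lambda>f. f $ 0) F = g * h"
    and cop: "coprime g h" and deg: "degree g > 0" "degree h > 0"
    and mon: "lead_coeff g = 1" "lead_coeff h = 1"
  shows "\<exists>G H. F = G * H \<and> lead_coeff G = 1 \<and> lead_coeff H = 1 \<and>
           degree G = degree g \<and> degree H = degree h"
proof -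
  define \<Phi> where "\<Phi> = fps_transpose F"
  have \<Phi>0: "\<Phi> $ 0 = g * h" by (simp add: \<Phi>_def fps_transpose_def red)
  have degF: "degree F = degree g + degree h"
  proof -
    have "degree (map_poly (\<lambda>f. f $ 0) F) = degree F"
      using F by (intro degree_map_poly) auto
    moreover have "g \<noteq> 0" "h \<noteq> 0" using deg by auto
    ultimately show ?thesis using red by (simp add: degree_mult_eq)
  qed
  \<comment> \<open>The coefficient of the top power of $X$ is the constant 1, so it contributes to \<open>\<Phi> $ 0\<close> only.\<close>
  have deg\<Phi>: "degree (\<Phi> $ k) < degree g + degree h" if "k > 0" for k
  proof -
    have "coeff (\<Phi> $ k) i = 0" if "i \<ge> degree F" for i
      using that F \<open>k > 0\<close> by (cases "i = degree F") (auto simp: \<Phi>_def coeff_eq_0)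
    thus ?thesis using deg degF
      by (metis add_gr_0 coeff_0 leading_coeff_0_iff linorder_not_less degree_0)
  qed
  define S where "S = (\<lambda>R. SOME uv. g * snd uv + fst uv * h = R \<and>
     degree (fst uv) < degree g \<and> degree (snd uv) < degree h)"
  have S: "g * snd (S R) + fst (S R) * h = R \<and> degree (fst (S R)) < degree g \<and> degree (snd (S R)) < degree h"
    if "degree R < degree g + degree h" for R
  proof -
    have "\<exists>uv. g * snd uv + fst uv * h = R \<and> degree (fst uv) < degree g \<and> degree (snd uv) < degree h"
      using coprime_poly_combination[OF cop deg that] by auto
    thus ?thesis unfolding S_def by (rule someI_ex)
  qed
  define hs where "hs = hensel_seq (fps_nth \<Phi>) S (g, h)"
  have hs0: "hs 0 = (g, h)" by (simp add: hs_def hensel_seq.simps)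
  define R where "R = (\<lambda>k. \<Phi> $ k - (\<Sum>i\<in>{1..<k}. fst (hs i) * snd (hs (k - i))))"
  have hs_rec: "hs k = S (R k)" if "k > 0" for k
    using that unfolding hs_def R_def by (subst hensel_seq.simps) auto
  have *: "degree (R k) < degree g + degree h \<and> degree (fst (hs k)) < degree g \<and> degree (snd (hs k)) < degree h"
    if "k > 0" for k
    using that
  proof (induction k rule: less_induct)
    case (less k)
    have "degree (\<Sum>i\<in>{1..<k}. fst (hs i) * snd (hs (k - i))) < degree g + degree h"
    proof (rule degree_sum_less)
      fix i assume "i \<in> {1..<k}"
      with less.IH[of i] less.IH[of "k - i"] show "degree (fst (hs i) * snd (hs (k - i))) < degree g + degree h"
        using degree_mult_le[of "fst (hs i)" "snd (hs (k - i))"] by auto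
    qed (use deg in auto)
    hence R: "degree (R k) < degree g + degree h"
      unfolding R_def using deg\<Phi>[OF less.prems] by (rule degree_diff_less[rotated])
    with S[OF R] less.prems show ?case by (simp add: hs_rec)
  qed
  define G where "G = Abs_fps (\<lambda>k. fst (hs k))"
  define H where "H = Abs_fps (\<lambda>k. snd (hs k))"
  have GH: "G * H = \<Phi>"
  proof (rule fps_ext)
    fix k show "(G * H) $ k = \<Phi> $ k"
    proof (cases "k = 0")
      case False
      hence "{0..k} = insert 0 (insert k {1..<k})" by auto
      hence "(G * H) $ k = g * snd (hs k) + fst (hs k) * h + (\<Sum>i\<in>{1..<k}. fst (hs i) * snd (hs (k - i)))"
        using False by (simp add: fps_mult_nth G_def H_def hs0)
      also have "g * snd (hs k) + fst (hs k) * h = R k"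
        using S[of "R k"] *[of k] hs_rec[of k] False by simp
      finally show ?thesis by (simp add: R_def)
    qed (simp add: G_def H_def hs0 \<Phi>0)
  qed
  have dG: "degree (G $ k) \<le> degree g" for k
    using *[of k] by (cases "k = 0") (auto simp: G_def hs0)
  have dH: "degree (H $ k) \<le> degree h" for k
    using *[of k] by (cases "k = 0") (auto simp: H_def hs0)
  obtain P where P: "degree P \<le> degree g" "fps_transpose P = G" using ex_fps_transpose dG by blast
  obtain Q where Q: "degree Q \<le> degree h" "fps_transpose Q = H" using ex_fps_transpose dH by blast
  have "F = P * Q"
    using GH by (simp add: fps_transpose_mult P Q \<Phi>_def flip: fps_transpose_eq_iff)
  moreover have "coeff P (degree g) = 1"
  proof (rule fps_ext)
    fix k
    show "coeff P (degree g) $ k = 1 $ k"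
      using mon *[of k] unfolding coeff_fps_transpose[symmetric] P
      by (cases "k = 0") (auto simp: G_def hs0 coeff_eq_0)
  qed
  moreover from this have "degree P = degree g"
    using P(1) le_degree[of P "degree g"] by simp
  moreover have "coeff Q (degree h) = 1"
  proof (rule fps_ext)
    fix k
    show "coeff Q (degree h) $ k = 1 $ k"
      using mon *[of k] unfolding coeff_fps_transpose[symmetric] Q
      by (cases "k = 0") (auto simp: H_def hs0 coeff_eq_0)
  qed
  moreover from this have "degree Q = degree h"
    using Q(1) le_degree[of Q "degree h"] by simp
  ultimately show ?thesis by metis
qed

section \<open>Ramification and splitting into linear factors\<close>

text \<open>
  The substitution $s \mapsto s^d$, that is, the passage to a $d$-th root of the variable.
\<close>

definition ramify :: "nat \<Rightarrow> 'a::idom fps \<Rightarrow> 'a fps" where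
  "ramify d f = f oo fps_X ^ d"

lemma inj_idom_hom_ramify:
  assumes "d > 0"
  shows "inj_idom_hom (ramify d :: 'a::idom fps \<Rightarrow> 'a fps)"
proof
  have X: "(fps_X ^ d :: 'a fps) $ 0 = 0" using assms by simp
  fix f g :: "'a fps"
  show "ramify d (f + g) = ramify d f + ramify d g"
    by (simp add: ramify_def fps_compose_add_distrib)
  show "ramify d (f * g) = ramify d f * ramify d g"
    by (simp add: ramify_def fps_compose_mult_distrib[OF X])
  show "f = 0" if "ramify d f = 0"
    using that by (simp add: ramify_def fps_compose_eq_0_iff[OF X])
qed (simp_all add: ramify_def)

lemma ramify_ramify:
  assumes "d > 0" "e > 0"
  shows "ramify d (ramify e f) = ramify (d * e) f"
proof -
  have "f oo (fps_X ^ e oo fps_X ^ d) = f oo fps_X ^ e oo fps_X ^ d"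
    using assms by (intro fps_compose_assoc) simp_all
  also have "(fps_X ^ e oo fps_X ^ d :: 'a fps) = fps_X ^ (d * e)"
    using assms by (subst fps_X_power_compose) (simp_all add: power_mult)
  finally show ?thesis by (simp add: ramify_def)
qed

lemma subdegree_ramify:
  assumes "d > 0"
  shows "subdegree (ramify d f) = d * subdegree f"
  using assms by (simp add: ramify_def)

lemma map_poly_ramify_ramify:
  assumes "d > 0" "e > 0"
  shows "map_poly (ramify d) (map_poly (ramify e) F) = map_poly (ramify (d * e)) F"
proof -
  have "ramify d 0 = (0 :: 'a fps)" "ramify e 0 = (0 :: 'a fps)" by (simp_all add: ramify_def)
  thus ?thesis using assms by (simp add: map_poly_map_poly o_def ramify_ramify)
qed

definition linear_product :: "'a::comm_ring_1 list \<Rightarrow> 'a poly" where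
  "linear_product ys = (\<Prod>y\<leftarrow>ys. [:- y, 1:])"

lemma linear_product_Nil [simp]: "linear_product [] = 1"
  and linear_product_Cons [simp]: "linear_product (y # ys) = [:- y, 1:] * linear_product ys"
  by (simp_all add: linear_product_def)

lemma linear_product_append: "linear_product (xs @ ys) = linear_product xs * linear_product ys"
  by (simp add: linear_product_def)

lemma degree_linear_product [simp]: "degree (linear_product (ys :: 'a::idom list)) = length ys"
  and linear_product_nonzero [simp]: "linear_product ys \<noteq> 0"
  by (induction ys) (simp_all add: degree_mult_eq del: mult_pCons_left)

lemma linear_product_replicate_0: "linear_product (replicate n 0) = monom 1 n"
  by (induction n) (simp_all add: monom_Suc)

lemma poly_linear_product: "poly (linear_product ys) x = (\<Prod>y\<leftarrow>ys. x - y)"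
  by (induction ys) (simp_all add: algebra_simps)

lemma map_poly_linear_product:
  assumes "d > 0"
  shows "map_poly (ramify d) (linear_product ys) = linear_product (map (ramify d) ys)"
proof -
  interpret inj_idom_hom "ramify d :: 'a fps \<Rightarrow> 'a fps" by (rule inj_idom_hom_ramify[OF assms])
  interpret R: map_poly_inj_idom_hom "ramify d :: 'a fps \<Rightarrow> 'a fps" ..
  show ?thesis by (induction ys) (simp_all add: R.hom_mult hom_uminus del: mult_pCons_left)
qed

lemma linear_product_pcompose_shift:
  "linear_product ys \<circ>\<^sub>p [:- a, 1:] = linear_product (map (\<lambda>y. y + a) ys)"
  by (induction ys) (simp_all add: pcompose_mult pcompose_pCons del: mult_pCons_left)

lemma linear_product_pcompose_scale:
  "linear_product (map (\<lambda>y. c * y) ys) \<circ>\<^sub>p [:0, c:] = smult (c ^ length ys) (linear_product ys)"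
proof (induction ys)
  case (Cons y ys)
  have "linear_product (map (\<lambda>y. c * y) (y # ys)) \<circ>\<^sub>p [:0, c:] =
      ([:- (c * y), 1:] \<circ>\<^sub>p [:0, c:]) * (linear_product (map (\<lambda>y. c * y) ys) \<circ>\<^sub>p [:0, c:])"
    by (simp only: list.map linear_product_Cons pcompose_mult)
  also have "[:- (c * y), 1:] \<circ>\<^sub>p [:0, c:] = smult c [:- y, 1:]"
    by (simp add: pcompose_pCons)
  finally show ?case
    by (simp only: Cons.IH linear_product_Cons mult_smult_left mult_smult_right smult_smult
        length_Cons power_Suc) (simp only: mult_ac)
qed simp

lemma pcompose_scale_cancel:
  fixes c :: "'a::idom"
  assumes "p \<circ>\<^sub>p [:0, c:] = q \<circ>\<^sub>p [:0, c:]" "c \<noteq> 0"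
  shows "p = q"
proof (rule poly_eqI)
  fix i
  have "coeff (p \<circ>\<^sub>p [:0, c:]) i = coeff (q \<circ>\<^sub>p [:0, c:]) i" using assms by simp
  thus "coeff p i = coeff q i" using assms(2) by (simp add: coeff_pcompose_linear)
qed

definition puiseux_splits :: "'a::idom fps poly \<Rightarrow> bool" where
  "puiseux_splits F \<longleftrightarrow> (\<exists>d>0. \<exists>ys. map_poly (ramify d) F = linear_product ys)"

lemma puiseux_splitsI:
  assumes "d > 0" "map_poly (ramify d) F = linear_product ys"
  shows "puiseux_splits F"
  using assms unfolding puiseux_splits_def by blast

lemma puiseux_splits_ramify:
  assumes "puiseux_splits (map_poly (ramify e) F)" "e > 0"
  shows "puiseux_splits F"
  using assms unfolding puiseux_splits_def
  by (metis map_poly_ramify_ramify nat_0_less_mult_iff)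

lemma puiseux_splits_mult:
  assumes "puiseux_splits F" "puiseux_splits G"
  shows "puiseux_splits (F * G)"
proof -
  obtain d ys where F: "d > 0" "map_poly (ramify d) F = linear_product ys"
    using assms unfolding puiseux_splits_def by blast
  obtain e zs where G: "e > 0" "map_poly (ramify e) G = linear_product zs"
    using assms unfolding puiseux_splits_def by blast
  have de: "d * e > 0" using F G by simp
  interpret inj_idom_hom "ramify (d * e) :: 'a fps \<Rightarrow> 'a fps" by (rule inj_idom_hom_ramify[OF de])
  interpret R: map_poly_inj_idom_hom "ramify (d * e) :: 'a fps \<Rightarrow> 'a fps" ..
  have "map_poly (ramify (d * e)) F = map_poly (ramify e) (map_poly (ramify d) F)"
    using F(1) G(1) by (simp add: map_poly_ramify_ramify mult.commute)
  also have "\<dots> = linear_product (map (ramify e) ys)"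
    by (simp only: F(2) map_poly_linear_product[OF G(1)])
  finally have 1: "map_poly (ramify (d * e)) F = linear_product (map (ramify e) ys)" .
  have "map_poly (ramify (d * e)) G = map_poly (ramify d) (map_poly (ramify e) G)"
    using F(1) G(1) by (simp add: map_poly_ramify_ramify)
  also have "\<dots> = linear_product (map (ramify d) zs)"
    by (simp only: G(2) map_poly_linear_product[OF F(1)])
  finally have "map_poly (ramify (d * e)) G = linear_product (map (ramify d) zs)" .
  with 1 have "map_poly (ramify (d * e)) (F * G) =
      linear_product (map (ramify e) ys @ map (ramify d) zs)"
    by (simp add: R.hom_mult linear_product_append)
  thus ?thesis using de unfolding puiseux_splits_def by blast
qed

lemma puiseux_splits_shift:
  assumes "puiseux_splits (F \<circ>\<^sub>p [:a, 1:])"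
  shows "puiseux_splits F"
proof -
  obtain d ys where F: "d > 0" "map_poly (ramify d) (F \<circ>\<^sub>p [:a, 1:]) = linear_product ys"
    using assms unfolding puiseux_splits_def by blast
  interpret inj_idom_hom "ramify d :: 'a fps \<Rightarrow> 'a fps" by (rule inj_idom_hom_ramify[OF F(1)])
  define b where "b = ramify d a"
  have "map_poly (ramify d) F \<circ>\<^sub>p [:b, 1:] = linear_product ys"
    using F(2) by (simp add: map_poly_pcompose b_def)
  hence "map_poly (ramify d) F \<circ>\<^sub>p ([:b, 1:] \<circ>\<^sub>p [:- b, 1:]) = linear_product ys \<circ>\<^sub>p [:- b, 1:]"
    by (simp only: pcompose_assoc)
  moreover have "[:b, 1:] \<circ>\<^sub>p [:- b, 1:] = [:0, 1:]" by (simp add: pcompose_pCons)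
  ultimately have "map_poly (ramify d) F = linear_product (map (\<lambda>y. y + b) ys)"
    by (simp only: pcompose_idR linear_product_pcompose_shift)
  thus ?thesis using F(1) unfolding puiseux_splits_def by blast
qed

text \<open>
  If $F(cX) = c^n G(X)$, the roots of \<open>F\<close> are those of \<open>G\<close> multiplied by \<open>c\<close>.
\<close>

lemma puiseux_splits_scale:
  assumes eq: "F \<circ>\<^sub>p [:0, c:] = smult (c ^ degree G) G" and "c \<noteq> 0" and "puiseux_splits G"
  shows "puiseux_splits F"
proof -
  obtain d ys where G: "d > 0" "map_poly (ramify d) G = linear_product ys"
    using assms unfolding puiseux_splits_def by blast
  interpret inj_idom_hom "ramify d :: 'a fps \<Rightarrow> 'a fps" by (rule inj_idom_hom_ramify[OF G(1)])
  have "degree G = degree (map_poly (ramify d) G)" by simp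
  hence len: "degree G = length ys" by (simp only: G degree_linear_product)
  define b where "b = ramify d c"
  have b: "b \<noteq> 0" using assms by (simp add: b_def)
  have "map_poly (ramify d) F \<circ>\<^sub>p [:0, b:] = map_poly (ramify d) (F \<circ>\<^sub>p [:0, c:])"
    by (simp add: map_poly_pcompose map_poly_pCons_hom b_def)
  also have "\<dots> = smult (b ^ length ys) (linear_product ys)"
    by (simp add: eq hom_distribs len b_def G)
  also have "\<dots> = linear_product (map (\<lambda>y. b * y) ys) \<circ>\<^sub>p [:0, b:]"
    by (simp add: linear_product_pcompose_scale)
  finally have "map_poly (ramify d) F = linear_product (map (\<lambda>y. b * y) ys)"
    using b by (rule pcompose_scale_cancel)
  thus ?thesis using G(1) unfolding puiseux_splits_def by blast
qed

section \<open>The theorem of Newton and Puiseux\<close>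

text \<open>
  The first slope of the Newton polygon. Choose \<open>k\<close> that minimizes
  $\sigma_i = \mathrm{ord}(F_i) / (n - i)$ among the coefficients $F_i$ with $i < n$. The
  substitution $X \mapsto s^{\sigma_k} X$ makes all coefficients divisible by the same power
  of $s$ as the leading one, and after division the coefficient of index \<open>k\<close> does not vanish at
  $s = 0$. The
  exponent $\sigma_k$ has denominator dividing $n - k$, so ramification by \<open>e = n - k\<close> turns it into the
  natural number \<open>p\<close>.
\<close>

lemma newton_rescale:
  fixes F :: "'a::idom fps poly"
  assumes F: "lead_coeff F = 1" and j: "j < degree F" "coeff F j \<noteq> 0"
  obtains e G p i where "e > 0" "degree G = degree F" "lead_coeff G = 1"
    "map_poly (ramify e) F \<circ>\<^sub>p [:0, fps_X ^ p:] = smult ((fps_X ^ p) ^ degree F) G"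
    "\<forall>i. coeff F i = 0 \<longrightarrow> coeff G i = 0"
    "i < degree F" "coeff G i $ 0 \<noteq> 0"
proof -
  define n where "n = degree F"
  define I where "I = {i. i < n \<and> coeff F i \<noteq> 0}"
  define slope where "slope = (\<lambda>i. of_nat (subdegree (coeff F i)) / of_nat (n - i) :: real)"
  have "finite I" "I \<noteq> {}" using j by (auto simp: I_def n_def)
  from arg_min_if_finite[OF this, of slope] obtain k where
    k: "k \<in> I" "\<And>i. i \<in> I \<Longrightarrow> slope k \<le> slope i" by (meson not_le)
  define e where "e = n - k"
  define p where "p = subdegree (coeff F k)"
  have e: "e > 0" using k by (simp add: e_def I_def)
  interpret inj_idom_hom "ramify e :: 'a fps \<Rightarrow> 'a fps" by (rule inj_idom_hom_ramify[OF e])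
  define b where "b = (\<lambda>i. ramify e (coeff F i))"
  define G where "G = (\<Sum>i\<le>n. monom (fps_shift (p * (n - i)) (b i)) i)"
  have coeff_G: "coeff G i = (if i \<le> n then fps_shift (p * (n - i)) (b i) else 0)" for i
    by (simp add: G_def coeff_sum)
  \<comment> \<open>Minimality of the slope at \<open>k\<close>, with the denominators cleared.\<close>
  have slope: "p * (n - i) \<le> subdegree (b i)" if "i \<in> I" for i
  proof -
    have "slope k \<le> slope i" using k(2) that by blast
    hence "real (p * (n - i)) \<le> real (e * subdegree (coeff F i))"
      using that e by (simp add: slope_def I_def p_def e_def[symmetric] field_simps)
    thus ?thesis unfolding b_def subdegree_ramify[OF e] by (simp only: of_nat_le_iff)
  qed
  have Gn: "coeff G n = 1" using F by (simp add: coeff_G b_def n_def)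
  hence deg_G: "degree G = n" by (intro antisym degree_le le_degree) (auto simp: coeff_G)
  have eq: "map_poly (ramify e) F \<circ>\<^sub>p [:0, fps_X ^ p:] = smult ((fps_X ^ p) ^ n) G"
  proof (rule poly_eqI)
    fix i
    have *: "b i = fps_X ^ (p * (n - i)) * coeff G i" if "i \<le> n"
    proof (cases "i \<in> I")
      case True
      thus ?thesis using that fps_shift_times_fps_X_power[OF slope[OF True]]
        by (simp add: coeff_G mult.commute)
    next
      case False
      hence "i = n \<or> coeff F i = 0" using that by (auto simp: I_def)
      thus ?thesis using that Gn F by (auto simp: n_def b_def coeff_G)
    qed
    show "coeff (map_poly (ramify e) F \<circ>\<^sub>p [:0, fps_X ^ p:]) i = coeff (smult ((fps_X ^ p) ^ n) G) i"
    proof (cases "i \<le> n")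
      case True
      have "(fps_X ^ p) ^ i * b i = (fps_X ^ (p * i) * fps_X ^ (p * (n - i))) * coeff G i"
        by (simp only: *[OF True] power_mult mult.assoc)
      also have "fps_X ^ (p * i) * fps_X ^ (p * (n - i)) = ((fps_X ^ p) ^ n :: 'a fps)"
        using True by (simp flip: power_add power_mult distrib_left)
      finally show ?thesis by (simp add: coeff_pcompose_linear b_def)
    qed (simp add: coeff_pcompose_linear coeff_G coeff_eq_0 n_def)
  qed
  have "b k $ (p * (n - k)) \<noteq> 0"
  proof -
    have "p * (n - k) = subdegree (b k)"
      unfolding b_def subdegree_ramify[OF e] by (simp add: p_def e_def)
    moreover have "b k \<noteq> 0" using k by (simp add: b_def I_def)
    ultimately show ?thesis by simp
  qed
  hence "coeff G k $ 0 \<noteq> 0" "k < degree F" using k by (auto simp: coeff_G I_def n_def)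
  moreover have "coeff G i = 0" if "coeff F i = 0" for i
    using that by (simp add: coeff_G b_def)
  ultimately show ?thesis
    using that[of e G p k] e deg_G Gn eq by (auto simp: n_def)
qed

text \<open>
  A polynomial that is not a power of a linear one has a root whose multiplicity is less than the
  degree, and splits into the corresponding power and a coprime cofactor. The case
  $q = (X - \alpha)^n$ is excluded: the coefficient $-n\alpha$ vanishes, so it would be $X^n$, but some
  lower coefficient is nonzero.
\<close>

lemma coprime_factorization_of_centred_poly:
  fixes q :: "complex poly"
  assumes q: "lead_coeff q = 1" "degree q = n" "n > 0" and c: "coeff q (n - 1) = 0"
    and i: "i < n" "coeff q i \<noteq> 0"
  obtains g h where "q = g * h" "coprime g h" "degree g > 0" "degree h > 0"
    "lead_coeff g = 1" "lead_coeff h = 1"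
proof -
  obtain \<alpha> where \<alpha>: "poly q \<alpha> = 0" using q alg_closed_imp_poly_has_root[of q] by blast
  define k where "k = order \<alpha> q"
  have q0: "q \<noteq> 0" using q by auto
  obtain h where h: "q = [:- \<alpha>, 1:] ^ k * h" "\<not> [:- \<alpha>, 1:] dvd h"
    using order_decomp[OF q0] unfolding k_def by blast
  have k: "k > 0" using \<alpha> q0 by (simp add: k_def order_root)
  have "prime_elem [:- \<alpha>, 1:]" by (rule prime_elem_linear_field_poly) simp
  hence "coprime [:- \<alpha>, 1:] h" using h(2) by (rule prime_elem_imp_coprime)
  hence cop: "coprime ([:- \<alpha>, 1:] ^ k) h" by simp
  have lh: "lead_coeff h = 1" using q(1) by (simp add: h(1) lead_coeff_mult lead_coeff_power)
  have "degree h > 0"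
  proof (rule ccontr)
    assume "\<not> degree h > 0"
    with lh have "h = 1" by (auto elim: degree_eq_zeroE)
    with h(1) have q': "q = [:- \<alpha>, 1:] ^ k" by simp
    hence kn: "k = n" using q(2) by (simp add: degree_power_eq)
    have "coeff q (n - 1) = of_nat (n choose (n - 1)) * (- \<alpha>) ^ (n - (n - 1))"
      using coeff_linear_poly_power[of "n - 1" n "- \<alpha>" 1] by (simp add: q' kn)
    also have "n - (n - 1) = 1" using q(3) by simp
    also have "n choose (n - 1) = n" using q(3) by (cases n) simp_all
    finally have "\<alpha> = 0" using c q(3) by simp
    hence "q = monom 1 n" by (simp add: q' kn monom_altdef)
    with i show False by simp
  qed
  moreover have "degree ([:- \<alpha>, 1:] ^ k) > 0" using k by (simp add: degree_power_eq)
  moreover have "lead_coeff ([:- \<alpha>, 1:] ^ k) = 1" by (simp only: lead_coeff_power) simp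
  ultimately show ?thesis using that[OF h(1) cop] lh by blast
qed

lemma coeff_shift_penultimate:
  fixes F :: "'a::idom poly"
  assumes F: "lead_coeff F = 1" and n: "degree F = Suc m"
  shows "coeff (F \<circ>\<^sub>p [:b, 1:]) m = coeff F m + of_nat (Suc m) * b"
proof -
  define R where "R = F - monom 1 (Suc m)"
  have "degree R \<le> m"
  proof (rule degree_le, intro allI impI)
    fix i assume "i > m"
    thus "coeff R i = 0" using F n by (cases "i = Suc m") (auto simp: R_def coeff_eq_0)
  qed
  hence "coeff (R \<circ>\<^sub>p [:b, 1:]) m = coeff R m"
    using lead_coeff_comp[of "[:b, 1:]" R] degree_pcompose[of R "[:b, 1:]"]
    by (cases "degree R = m") (auto simp: coeff_eq_0)
  moreover have "F \<circ>\<^sub>p [:b, 1:] = R \<circ>\<^sub>p [:b, 1:] + [:b, 1:] ^ Suc m"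
    by (simp add: R_def pcompose_diff monom_altdef pcompose_hom.hom_power pcompose_pCons del: power_Suc)
  moreover have "coeff ([:b, 1:] ^ Suc m) m = of_nat (Suc m) * b"
    by (subst coeff_linear_poly_power) (simp_all add: Suc_diff_le)
  ultimately show ?thesis by (simp add: R_def)
qed

text \<open>
  Induction on the degree. A translation removes the second coefficient from the top. Then either the
  polynomial is a power of $X$, or \<open>newton_rescale\<close> makes some lower coefficient a unit. In the latter
  case the reduction modulo $s$ factors into coprime parts of smaller degree by
  \<open>coprime_factorization_of_centred_poly\<close>, Hensel's lemma lifts this factorization, and the induction
  hypothesis applies to both lifted factors.
\<close>

theorem newton_puiseux:
  fixes F :: "complex fps poly"
  assumes "lead_coeff F = 1"
  shows "puiseux_splits F"
  using assms
proof (induction "degree F" arbitrary: F rule: less_induct)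
  case less
  show ?case
  proof (cases "degree F")
    case 0
    with less.prems have "F = 1" by (auto elim: degree_eq_zeroE)
    hence "map_poly (ramify 1) F = linear_product []" by (simp add: ramify_def)
    thus ?thesis by (rule puiseux_splitsI[rotated]) simp
  next
    case (Suc m)
    \<comment> \<open>The arithmetic mean of the roots: moving it to 0 makes the coefficient of index \<open>m\<close> vanish.\<close>
    define b where "b = - (coeff F m * fps_const (1 / of_nat (Suc m)))"
    have b: "coeff F m + of_nat (Suc m) * b = 0"
    proof -
      have "of_nat (Suc m) * fps_const (1 / of_nat (Suc m)) = (1 :: complex fps)"
        by (simp only: fps_of_nat[symmetric] fps_const_mult) (simp del: of_nat_Suc)
      thus ?thesis by (simp add: b_def algebra_simps del: of_nat_Suc)
    qed
    define F1 where "F1 = F \<circ>\<^sub>p [:b, 1:]"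
    have F1: "degree F1 = Suc m" "lead_coeff F1 = 1" "coeff F1 m = 0"
      using Suc less.prems lead_coeff_comp[of "[:b, 1:]" F] coeff_shift_penultimate[OF less.prems Suc, of b] b
      by (simp_all add: F1_def degree_pcompose)
    have "puiseux_splits F1"
    proof (cases "\<exists>j<degree F1. coeff F1 j \<noteq> 0")
      case False
      have "F1 = monom 1 (Suc m)"
      proof (rule poly_eqI)
        fix i show "coeff F1 i = coeff (monom 1 (Suc m)) i"
          using F1 False by (cases i "Suc m" rule: linorder_cases) (auto simp: coeff_eq_0)
      qed
      hence "map_poly (ramify 1) F1 = linear_product (replicate (Suc m) 0)"
        by (simp only: linear_product_replicate_0) (simp add: ramify_def map_poly_monom)
      thus ?thesis by (rule puiseux_splitsI[rotated]) simp
    next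
      case True
      then obtain j where j: "j < degree F1" "coeff F1 j \<noteq> 0" by blast
      obtain e G p i where G: "e > 0" "degree G = degree F1" "lead_coeff G = 1"
        "map_poly (ramify e) F1 \<circ>\<^sub>p [:0, fps_X ^ p:] = smult ((fps_X ^ p) ^ degree F1) G"
        "\<forall>i. coeff F1 i = 0 \<longrightarrow> coeff G i = 0" "i < degree F1" "coeff G i $ 0 \<noteq> 0"
        using newton_rescale[OF F1(2) j] by metis
      define q where "q = map_poly (\<lambda>f. f $ 0) G"
      have coeff_q: "coeff q k = coeff G k $ 0" for k by (simp add: q_def coeff_map_poly)
      have deg_q: "degree q = Suc m"
      proof -
        have "coeff q (Suc m) = 1" using G F1 by (simp add: coeff_q)
        hence "Suc m \<le> degree q" by (intro le_degree) simp
        moreover have "degree q \<le> Suc m"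
          using G F1 by (intro degree_le) (auto simp: coeff_q coeff_eq_0)
        ultimately show ?thesis by simp
      qed
      have q: "lead_coeff q = 1" "coeff q (Suc m - 1) = 0" "i < Suc m" "coeff q i \<noteq> 0"
        using G F1 deg_q by (simp_all add: coeff_q)
      obtain g h where gh: "q = g * h" "coprime g h" "degree g > 0" "degree h > 0"
        "lead_coeff g = 1" "lead_coeff h = 1"
        using coprime_factorization_of_centred_poly[OF q(1) deg_q _ q(2-4)] by blast
      have "g \<noteq> 0" "h \<noteq> 0" using gh(3,4) by auto
      hence "degree q = degree g + degree h" unfolding gh(1) by (rule degree_mult_eq)
      with gh deg_q Suc have lt: "degree g < degree F" "degree h < degree F" by auto
      obtain A B where AB: "G = A * B" "lead_coeff A = 1" "lead_coeff B = 1"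
          "degree A = degree g" "degree B = degree h"
        using hensel_fps[OF G(3) gh(1)[unfolded q_def] gh(2-6)] by blast
      have "puiseux_splits A" "puiseux_splits B"
        using less.hyps[of A] less.hyps[of B] lt AB by auto
      hence "puiseux_splits G" unfolding AB(1) by (rule puiseux_splits_mult)
      hence "puiseux_splits (map_poly (ramify e) F1)"
        by (rule puiseux_splits_scale[rotated 2]) (use G(2,4) in auto)
      thus ?thesis using G(1) by (rule puiseux_splits_ramify)
    qed
    thus ?thesis unfolding F1_def by (rule puiseux_splits_shift)
  qed
qed

section \<open>Roots close to an approximate root\<close>

lemma subdegree_prod_list:
  fixes fs :: "'a::idom fps list"
  assumes "0 \<notin> set fs"
  shows "subdegree (prod_list fs) = (\<Sum>f\<leftarrow>fs. subdegree f)"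
  using assms by (induction fs) (auto simp: prod_list_zero_iff)

lemma ex_ge_average:
  fixes h :: "'b \<Rightarrow> nat"
  assumes "xs \<noteq> []"
  shows "\<exists>x\<in>set xs. sum_list (map h xs) \<le> length xs * h x"
proof (rule ccontr)
  assume "\<not> ?thesis"
  hence less: "length xs * h x < sum_list (map h xs)" if "x \<in> set xs" for x
    using that by (meson not_le)
  have "length xs * sum_list (map h xs) = (\<Sum>x\<leftarrow>xs. length xs * h x)"
    by (simp add: sum_list_const_mult)
  also have "\<dots> < (\<Sum>x\<leftarrow>xs. sum_list (map h xs))"
    using assms less by (intro sum_list_strict_mono) auto
  also have "\<dots> = length xs * sum_list (map h xs)"
    by (simp add: sum_list_triv)
  finally show False by simp
qed

text \<open>
  If $G = c \prod_k (X - \eta_k)$ has degree $n$, the order of $G(\theta)$ is the order of $c$ plus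
  the sum of those of the $\theta - \eta_k$; take $\eta_k$ with $\mathrm{ord}(\theta - \eta_k)$ at
  least the average. As \<open>G\<close> need not be monic, its roots need not be power series. The splitting is
  applied to the monic polynomial whose roots are the $y_k = c \eta_k$ instead, and the assumption on
  the orders guarantees that the chosen $y_k$ is divisible by $c$.
\<close>

theorem puiseux_root_near:
  fixes G :: "complex fps poly"
  assumes n: "degree G > 0" and w: "poly G \<theta> \<noteq> 0"
    and le: "subdegree (lead_coeff G) \<le> subdegree (poly G \<theta>)"
  obtains e \<eta> where "e > 0" "poly (map_poly (ramify e) G) \<eta> = 0"
    "e * subdegree (poly G \<theta>) \<le>
       degree G * subdegree (ramify e \<theta> - \<eta>) + e * subdegree (lead_coeff G)"
proof -
  define n where "n = degree G"
  define c where "c = lead_coeff G"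
  have c: "c \<noteq> 0" using w by (auto simp: c_def)
  \<comment> \<open>The monic polynomial with $H(cX) = c^{n-1} G(X)$.\<close>
  define H where "H = monom 1 n + (\<Sum>i<n. monom (coeff G i * c ^ (n - 1 - i)) i)"
  have coeff_H: "coeff H i = (if i < n then coeff G i * c ^ (n - 1 - i) else if i = n then 1 else 0)" for i
    by (auto simp: H_def coeff_sum)
  have "degree H = n" by (intro antisym degree_le le_degree) (auto simp: coeff_H)
  hence "lead_coeff H = 1" by (simp add: coeff_H)
  from newton_puiseux[OF this] obtain e ys where
    e: "e > 0" and ys: "map_poly (ramify e) H = linear_product ys"
    unfolding puiseux_splits_def by blast
  interpret inj_idom_hom "ramify e :: complex fps \<Rightarrow> complex fps" by (rule inj_idom_hom_ramify[OF e])
  define c' where "c' = ramify e c"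
  define G' where "G' = map_poly (ramify e) G"
  have c': "c' \<noteq> 0" using c by (simp add: c'_def)
  have "length ys = degree (map_poly (ramify e) H)" by (simp only: ys degree_linear_product)
  hence len: "length ys = n" using \<open>degree H = n\<close> by simp
  have "H \<circ>\<^sub>p [:0, c:] = smult (c ^ (n - 1)) G"
  proof (rule poly_eqI)
    fix i
    show "coeff (H \<circ>\<^sub>p [:0, c:]) i = coeff (smult (c ^ (n - 1)) G) i"
    proof (cases i n rule: linorder_cases)
      case less
      hence "c ^ i * c ^ (n - 1 - i) = c ^ (n - 1)" by (simp flip: power_add)
      thus ?thesis using less by (simp add: coeff_pcompose_linear coeff_H mult_ac flip: mult.assoc)
    next
      case equal
      have "c ^ n = c ^ (n - 1) * c" using n by (cases n) (simp_all add: n_def mult.commute)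
      thus ?thesis using equal by (simp add: coeff_pcompose_linear coeff_H) (simp add: n_def c_def)
    next
      case greater
      thus ?thesis by (simp add: coeff_pcompose_linear coeff_H coeff_eq_0 n_def)
    qed
  qed
  hence "map_poly (ramify e) (H \<circ>\<^sub>p [:0, c:]) = map_poly (ramify e) (smult (c ^ (n - 1)) G)"
    by simp
  hence eq: "linear_product ys \<circ>\<^sub>p [:0, c':] = smult (c' ^ (n - 1)) G'"
    by (simp add: map_poly_pcompose map_poly_pCons_hom ys hom_distribs c'_def G'_def)
  have eval: "(\<Prod>y\<leftarrow>ys. c' * x - y) = c' ^ (n - 1) * poly G' x" for x
  proof -
    have "poly (linear_product ys \<circ>\<^sub>p [:0, c':]) x = poly (smult (c' ^ (n - 1)) G') x"
      by (simp only: eq)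
    thus ?thesis by (simp add: poly_pcompose poly_linear_product mult.commute)
  qed
  define \<theta>' where "\<theta>' = ramify e \<theta>"
  have w': "poly G' \<theta>' = ramify e (poly G \<theta>)" by (simp add: G'_def \<theta>'_def)
  have "poly G' \<theta>' \<noteq> 0" using w by (simp add: w')
  hence nz: "(\<Prod>y\<leftarrow>ys. c' * \<theta>' - y) \<noteq> 0" using c' by (simp add: eval)
  define h where "h = (\<lambda>y. subdegree (c' * \<theta>' - y))"
  have "sum_list (map h ys) = subdegree (\<Prod>y\<leftarrow>ys. c' * \<theta>' - y)"
    using nz by (subst subdegree_prod_list) (auto simp: prod_list_zero_iff h_def o_def)
  also have "\<dots> = (n - 1) * subdegree c' + subdegree (poly G' \<theta>')"
    using c' \<open>poly G' \<theta>' \<noteq> 0\<close> by (simp add: eval)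
  finally have sum: "sum_list (map h ys) = (n - 1) * subdegree c' + subdegree (poly G' \<theta>')" .
  have "ys \<noteq> []" using len n by (auto simp: n_def)
  from ex_ge_average[OF this, of h] obtain y where y: "y \<in> set ys"
    "(n - 1) * subdegree c' + subdegree (poly G' \<theta>') \<le> n * h y"
    unfolding sum len by blast
  have c'_le: "subdegree c' \<le> subdegree (poly G' \<theta>')"
    using le e unfolding w' c'_def c_def subdegree_ramify[OF e] by simp
  have n1: "(n - 1) * subdegree c' + subdegree c' = n * subdegree c'"
    using n by (cases n) (simp_all add: n_def)
  with y(2) c'_le have "n * subdegree c' \<le> n * h y" by linarith
  hence "subdegree c' \<le> h y" using n by (simp add: n_def)
  moreover have y0: "c' * \<theta>' - y \<noteq> 0" using nz y(1) by (auto simp: prod_list_zero_iff)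
  ultimately have "c' dvd c' * \<theta>' - y" using c' by (simp add: fps_dvd_iff h_def)
  then obtain \<delta> where \<delta>: "c' * \<theta>' - y = c' * \<delta>" by blast
  define \<eta> where "\<eta> = \<theta>' - \<delta>"
  have y_eq: "y = c' * \<eta>" using \<delta> by (simp add: \<eta>_def algebra_simps)
  have "c' * \<eta> - y = 0" by (simp add: y_eq)
  hence "(\<Prod>z\<leftarrow>ys. c' * \<eta> - z) = 0" using y(1) by (auto simp: prod_list_zero_iff)
  hence root: "poly G' \<eta> = 0" using c' by (simp add: eval)
  have "\<delta> \<noteq> 0" using \<delta> y0 by auto
  hence "h y = subdegree c' + subdegree \<delta>" using c' unfolding h_def \<delta> by simp
  hence "(n - 1) * subdegree c' + subdegree (poly G' \<theta>') \<le> n * subdegree c' + n * subdegree \<delta>"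
    using y(2) by (simp add: distrib_left)
  with n1 have "subdegree (poly G' \<theta>') \<le> n * subdegree \<delta> + subdegree c'" by linarith
  moreover have "\<delta> = ramify e \<theta> - \<eta>" by (simp add: \<eta>_def \<theta>'_def)
  ultimately have "e * subdegree (poly G \<theta>) \<le> n * subdegree (ramify e \<theta> - \<eta>) + e * subdegree c"
    by (simp only: w' c'_def subdegree_ramify[OF e])
  thus ?thesis using that e root unfolding G'_def n_def c_def by blast
qed

section \<open>Polynomials expanded at a point\<close>

text \<open>
  The expansion of $c(\xi + s^d)$ in powers of $s$: a polynomial in $t$, where $s^d = t - \xi$.
\<close>

definition centred_fps :: "'a \<Rightarrow> nat \<Rightarrow> 'a::idom poly \<Rightarrow> 'a fps" where
  "centred_fps \<xi> d c = fps_of_poly (c \<circ>\<^sub>p ([:\<xi>:] + monom 1 d))"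

lemma degree_const_plus_monom:
  assumes "d > 0"
  shows "degree ([:\<xi>:] + monom 1 d :: 'a::idom poly) = d"
  using assms by (subst degree_add_eq_right) (simp_all add: degree_monom_eq)

lemma inj_idom_hom_centred_fps:
  assumes "d > 0"
  shows "inj_idom_hom (centred_fps \<xi> d)"
proof
  fix c c' :: "'a poly"
  show "centred_fps \<xi> d (c + c') = centred_fps \<xi> d c + centred_fps \<xi> d c'"
    by (simp add: centred_fps_def pcompose_add fps_of_poly_add)
  show "centred_fps \<xi> d (c * c') = centred_fps \<xi> d c * centred_fps \<xi> d c'"
    by (simp add: centred_fps_def pcompose_mult fps_of_poly_mult)
  show "c = 0" if "centred_fps \<xi> d c = 0"
  proof -
    have "c \<circ>\<^sub>p ([:\<xi>:] + monom 1 d) = 0"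
      using that fps_of_poly_eq_iff[of "c \<circ>\<^sub>p ([:\<xi>:] + monom 1 d)" 0] by (simp add: centred_fps_def)
    moreover have "degree ([:\<xi>:] + monom 1 d) > 0"
      using assms by (simp add: degree_const_plus_monom)
    ultimately show ?thesis by (rule pcompose_eq_0)
  qed
qed (simp_all add: centred_fps_def pcompose_1)

lemma subdegree_centred_fps_le:
  assumes "d > 0" "c \<noteq> 0"
  shows "subdegree (centred_fps \<xi> d c) \<le> d * degree c"
proof -
  interpret inj_idom_hom "centred_fps \<xi> d" by (rule inj_idom_hom_centred_fps[OF assms(1)])
  let ?p = "c \<circ>\<^sub>p ([:\<xi>:] + monom 1 d)"
  have "centred_fps \<xi> d c \<noteq> 0" using assms by simp
  hence "?p \<noteq> 0" unfolding centred_fps_def by auto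
  hence "subdegree (centred_fps \<xi> d c) \<le> degree ?p"
    unfolding centred_fps_def
    by (intro subdegree_leI) (simp only: fps_of_poly_nth leading_coeff_0_iff not_False_eq_True)
  also have "\<dots> = d * degree c"
    by (simp add: degree_pcompose degree_const_plus_monom[OF assms(1)])
  finally show ?thesis .
qed

lemma centred_fps_nth_0:
  assumes "d > 0"
  shows "centred_fps \<xi> d c $ 0 = poly c \<xi>"
  using assms by (simp add: centred_fps_def poly_pcompose poly_monom zero_power flip: poly_0_coeff_0)

lemma eval2_mult:
  fixes f g :: "'a::comm_ring_1 poly poly"
  shows "eval2 (f * g) x y = eval2 f x y * eval2 g x y"
proof -
  interpret h: map_poly_comm_ring_hom "\<lambda>p :: 'a poly. poly p x" ..
  show ?thesis by (simp add: eval2_def h.hom_mult)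
qed

lemma zero_locus_dvd: "g dvd f \<Longrightarrow> zero_locus g \<subseteq> zero_locus f"
  by (auto simp: zero_locus_def eval2_mult elim!: dvdE)

text \<open>
  Taking constant terms is a ring homomorphism, and it sends $t = \xi + s^d$ to $\xi$.
\<close>

lemma root_at_centre:
  assumes "d > 0" "poly (map_poly (centred_fps \<xi> d) g) \<eta> = 0"
  shows "eval2 g \<xi> (\<eta> $ 0) = 0"
proof -
  interpret h: comm_ring_hom "\<lambda>f :: 'a::idom fps. f $ 0"
    by standard simp_all
  interpret c: inj_idom_hom "centred_fps \<xi> d" by (rule inj_idom_hom_centred_fps[OF assms(1)])
  have "map_poly (\<lambda>f. f $ 0) (map_poly (centred_fps \<xi> d) g) = map_poly (\<lambda>c. poly c \<xi>) g"
    by (simp add: map_poly_map_poly o_def centred_fps_nth_0[OF assms(1)])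
  moreover have "poly (map_poly (\<lambda>f. f $ 0) (map_poly (centred_fps \<xi> d) g)) (\<eta> $ 0) =
      poly (map_poly (centred_fps \<xi> d) g) \<eta> $ 0"
    by (rule h.poly_map_poly)
  ultimately show ?thesis using assms(2) by (simp add: eval2_def)
qed

section \<open>Power series in a root of the variable as Puiseux series\<close>

text \<open>
  The substitution $s \mapsto (t - \xi_1)^{1/d}$, meaningful for \<open>d > 0\<close>.
\<close>

definition puiseux_of_fps :: "nat \<Rightarrow> 'a::comm_ring_1 fps \<Rightarrow> 'a puiseux" where
  "puiseux_of_fps d f = Abs_puiseux (of_fls_root d (fps_to_fls f))"

lemma puiseux_nth_of_fps':
  assumes "d > 0"
  shows "puiseux_nth (puiseux_of_fps d f) = of_fls_root d (fps_to_fls f)"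
  unfolding puiseux_of_fps_def
  by (rule Abs_puiseux_inverse) (simp add: is_puiseux_of_fls_root[OF assms])

lemma puiseux_nth_of_fps:
  assumes "d > 0"
  shows "puiseux_nth (puiseux_of_fps d f) (of_int k / of_nat d) = (if k < 0 then 0 else f $ nat k)"
  using assms by (simp add: puiseux_nth_of_fps' of_fls_root_def)

lemma puiseux_nth_of_fps_nonzeroE:
  assumes "d > 0" "puiseux_nth (puiseux_of_fps d f) r \<noteq> 0"
  obtains k where "r = of_nat k / of_nat d" "f $ k \<noteq> 0"
proof -
  have r: "r * of_nat d \<in> \<int>" "fps_to_fls f $$ \<lfloor>r * of_nat d\<rfloor> \<noteq> 0"
    using assms by (auto simp: puiseux_nth_of_fps' of_fls_root_def split: if_splits)
  from r(1) obtain k where k: "r * of_nat d = of_int k" by (elim Ints_cases)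
  with r(2) have "k \<ge> 0" "f $ nat k \<noteq> 0" by (auto split: if_splits)
  moreover from this k have "r = of_nat (nat k) / of_nat d" using assms(1) by (simp add: field_simps)
  ultimately show ?thesis using that by blast
qed

lemma puiseux_eqI: "puiseux_nth p = puiseux_nth q \<Longrightarrow> p = q"
  by (simp add: puiseux_nth_inject)

lemma puiseux_of_fps_monom:
  assumes "d > 0"
  shows "puiseux_of_fps d (fps_const a * fps_X ^ k) = puiseux_monom a (of_nat k / of_nat d)"
proof (rule puiseux_eqI)
  have "fps_to_fls (fps_const a * fps_X ^ k) = fls_shift (- int k) (fls_const a)"
    by (rule fls_eqI) (auto simp: fls_shift_nth)
  thus "puiseux_nth (puiseux_of_fps d (fps_const a * fps_X ^ k)) =
      puiseux_nth (puiseux_monom a (of_nat k / of_nat d))"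
    using of_fls_root_monom[OF assms, of "int k" a]
    by (simp add: puiseux_nth_of_fps'[OF assms] puiseux_monom.rep_eq)
qed

lemma puiseux_of_fps_const:
  assumes "d > 0"
  shows "puiseux_of_fps d (fps_const a) = puiseux_const a"
  using puiseux_of_fps_monom[OF assms, of a 0] by simp

lemma puiseux_one_eq: "(1 :: 'a::comm_ring_1 puiseux) = puiseux_const 1"
  by (rule puiseux_eqI) (simp add: one_puiseux.rep_eq puiseux_monom.rep_eq)

lemma inj_comm_ring_hom_puiseux_of_fps:
  assumes d: "d > 0"
  shows "inj_comm_ring_hom (puiseux_of_fps d :: 'a::comm_ring_1 fps \<Rightarrow> _)"
proof
  fix f g :: "'a fps"
  show "puiseux_of_fps d (f + g) = puiseux_of_fps d f + puiseux_of_fps d g"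
    by (rule puiseux_eqI)
       (simp add: puiseux_nth_of_fps'[OF d] plus_puiseux.rep_eq of_fls_root_add)
  show "puiseux_of_fps d (f * g) = puiseux_of_fps d f * puiseux_of_fps d g"
    by (rule puiseux_eqI)
       (simp add: puiseux_nth_of_fps'[OF d] times_puiseux.rep_eq fls_times_fps_to_fls puiseux_conv_of_fls_root[OF d])
  show "puiseux_of_fps d 1 = (1 :: 'a puiseux)"
    using puiseux_of_fps_const[OF d, of "1 :: 'a"] by (simp add: puiseux_one_eq)
  show "puiseux_of_fps d 0 = (0 :: 'a puiseux)"
    by (rule puiseux_eqI) (simp add: puiseux_nth_of_fps'[OF d] zero_puiseux.rep_eq of_fls_root_0)
  show "f = 0" if "puiseux_of_fps d f = 0"
  proof (rule fps_ext)
    fix k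
    show "f $ k = 0 $ k"
      using puiseux_nth_of_fps[OF d, of f "int k"] that by (simp add: zero_puiseux.rep_eq)
  qed
qed

text \<open>
  Both sides substitute $(t-\xi_1)^{1/d}$ into \<open>f\<close>, because $s^e$ becomes
  $((t-\xi_1)^{1/(de)})^e$.
\<close>

lemma puiseux_of_fps_ramify:
  assumes "d > 0" "e > 0"
  shows "puiseux_of_fps (d * e) (ramify e f) = puiseux_of_fps d f"
proof (rule puiseux_eqI, rule ext)
  fix r :: rat
  have de: "d * e > 0" using assms by simp
  have nth: "ramify e f $ k = (if e dvd k then f $ (k div e) else 0)" for k
    using assms by (simp add: ramify_def fps_nth_compose_X_power)
  show "puiseux_nth (puiseux_of_fps (d * e) (ramify e f)) r = puiseux_nth (puiseux_of_fps d f) r"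
  proof (cases "\<exists>k. r = of_int k / of_nat d")
    case True
    then obtain k where k: "r = of_int k / of_nat d" by blast
    hence r': "r = of_int (k * int e) / of_nat (d * e)" using assms by simp
    show ?thesis
      unfolding puiseux_nth_of_fps[OF assms(1), of f k, folded k]
        puiseux_nth_of_fps[OF de, of "ramify e f" "k * int e", folded r']
      using assms by (auto simp: nth mult_less_0_iff nat_mult_distrib)
  next
    case False
    have "puiseux_nth (puiseux_of_fps d f) r = 0"
      using False by (metis puiseux_nth_of_fps_nonzeroE[OF assms(1)] of_int_of_nat_eq)
    moreover have "puiseux_nth (puiseux_of_fps (d * e) (ramify e f)) r = 0"
    proof (rule ccontr)
      assume "puiseux_nth (puiseux_of_fps (d * e) (ramify e f)) r \<noteq> 0"
      then obtain k where k: "r = of_nat k / of_nat (d * e)" "ramify e f $ k \<noteq> 0"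
        by (rule puiseux_nth_of_fps_nonzeroE[OF de])
      then obtain j where "k = e * j" by (auto simp: nth split: if_splits)
      hence "r = of_int (int j) / of_nat d" using k(1) assms by simp
      with False show False by blast
    qed
    ultimately show ?thesis by simp
  qed
qed

lemma puiseux_of_fps_centred_fps:
  assumes "d > 0"
  shows "puiseux_of_fps d (centred_fps \<xi> d c) =
           poly (map_poly puiseux_const c) (puiseux_const \<xi> + puiseux_X)"
proof (induction c)
  case 0
  interpret inj_comm_ring_hom "puiseux_of_fps d :: 'a fps \<Rightarrow> _"
    by (rule inj_comm_ring_hom_puiseux_of_fps[OF assms])
  show ?case by (simp add: centred_fps_def)
next
  case (pCons a c)
  interpret inj_comm_ring_hom "puiseux_of_fps d :: 'a fps \<Rightarrow> _"
    by (rule inj_comm_ring_hom_puiseux_of_fps[OF assms])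
  have X: "puiseux_of_fps d (fps_X ^ d) = (puiseux_X :: 'a puiseux)"
    using puiseux_of_fps_monom[OF assms, of 1 d] assms by simp
  have "centred_fps \<xi> d (pCons a c) = fps_const a + (fps_const \<xi> + fps_X ^ d) * centred_fps \<xi> d c"
    by (simp add: centred_fps_def pcompose_pCons fps_of_poly_add fps_of_poly_mult fps_of_poly_const
        fps_of_poly_monom')
  moreover have "map_poly puiseux_const (pCons a c) = pCons (puiseux_const a) (map_poly puiseux_const c)"
    using hom_zero puiseux_of_fps_const[OF assms, of "0 :: 'a"]
    by (intro poly_eqI) (simp add: coeff_map_poly coeff_pCons split: nat.splits)
  ultimately show ?case
    by (simp add: hom_add hom_mult X puiseux_of_fps_const[OF assms] pCons.IH)
qed

text \<open>
  Both sides are $c(\xi + s^{de})$; the two expansions agree because they define the same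
  Puiseux series.
\<close>

lemma ramify_centred_fps:
  assumes "d > 0" "e > 0"
  shows "ramify e (centred_fps \<xi> d c) = centred_fps \<xi> (d * e) c"
proof -
  have de: "d * e > 0" using assms by simp
  interpret inj_comm_ring_hom "puiseux_of_fps (d * e) :: 'a fps \<Rightarrow> _"
    by (rule inj_comm_ring_hom_puiseux_of_fps[OF de])
  have "puiseux_of_fps (d * e) (ramify e (centred_fps \<xi> d c)) =
      puiseux_of_fps (d * e) (centred_fps \<xi> (d * e) c)"
    by (simp only: puiseux_of_fps_ramify[OF assms] puiseux_of_fps_centred_fps[OF assms(1)]
        puiseux_of_fps_centred_fps[OF de])
  thus ?thesis by simp
qed

text \<open>
  The bridge between the Puiseux series of the theorem and power series: substitution into a bivariate
  polynomial can be computed in $\mathbb{C}[[s]]$.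
\<close>

lemma puiseux_subst_of_fps:
  assumes "d > 0"
  shows "puiseux_subst f \<xi> (puiseux_of_fps d \<theta>) =
           puiseux_of_fps d (poly (map_poly (centred_fps \<xi> d) f) \<theta>)"
proof -
  interpret inj_comm_ring_hom "puiseux_of_fps d :: complex fps \<Rightarrow> _"
    by (rule inj_comm_ring_hom_puiseux_of_fps[OF assms])
  interpret E: inj_idom_hom "centred_fps \<xi> d" by (rule inj_idom_hom_centred_fps[OF assms])
  have const0: "puiseux_const 0 = (0 :: complex puiseux)"
    using hom_zero puiseux_of_fps_const[OF assms, of "0 :: complex"] by simp
  have "map_poly (\<lambda>c. poly c (puiseux_const \<xi> + puiseux_X)) (map_poly (map_poly puiseux_const) f) =
      map_poly (puiseux_of_fps d) (map_poly (centred_fps \<xi> d) f)"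
    by (simp add: map_poly_map_poly o_def const0 puiseux_of_fps_centred_fps[OF assms])
  thus ?thesis unfolding puiseux_subst_def eval2_def by simp
qed

lemma puiseux_ord_greater_iff:
  "puiseux_ord p > Fin q \<longleftrightarrow> (\<forall>r\<le>q. puiseux_nth p r = 0)"
proof (cases "p = 0")
  case True
  thus ?thesis by (simp add: puiseux_ord_def zero_puiseux.rep_eq)
next
  case False
  obtain r where r: "puiseux_ord p = Fin r" "puiseux_nth p r \<noteq> 0" "\<And>s. puiseux_nth p s \<noteq> 0 \<Longrightarrow> r \<le> s"
    using puiseux_ord_nonzero[OF False] by blast
  show ?thesis
  proof
    assume "puiseux_ord p > Fin q"
    hence "q < r" by (simp add: r(1))
    thus "\<forall>s\<le>q. puiseux_nth p s = 0" using r(3) by fastforce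
  next
    assume "\<forall>s\<le>q. puiseux_nth p s = 0"
    hence "q < r" using r(2) by (meson not_le)
    thus "puiseux_ord p > Fin q" by (simp add: r(1))
  qed
qed

lemma puiseux_ord_of_fps_greater_iff:
  assumes "d > 0"
  shows "puiseux_ord (puiseux_of_fps d f) > Fin q \<longleftrightarrow>
           (f \<noteq> 0 \<longrightarrow> of_nat (subdegree f) > q * of_nat d)"
proof
  assume "puiseux_ord (puiseux_of_fps d f) > Fin q"
  hence 0: "puiseux_nth (puiseux_of_fps d f) r = 0" if "r \<le> q" for r
    using that by (simp add: puiseux_ord_greater_iff)
  show "f \<noteq> 0 \<longrightarrow> of_nat (subdegree f) > q * of_nat d"
  proof
    assume "f \<noteq> 0"
    hence "puiseux_nth (puiseux_of_fps d f) (of_int (int (subdegree f)) / of_nat d) \<noteq> 0"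
      using puiseux_nth_of_fps[OF assms, of f "int (subdegree f)"] by simp
    hence "\<not> of_nat (subdegree f) / of_nat d \<le> q" using 0 by auto
    thus "of_nat (subdegree f) > q * of_nat d" using assms by (simp add: field_simps)
  qed
next
  assume f: "f \<noteq> 0 \<longrightarrow> of_nat (subdegree f) > q * of_nat d"
  show "puiseux_ord (puiseux_of_fps d f) > Fin q"
    unfolding puiseux_ord_greater_iff
  proof (intro allI impI, rule ccontr)
    fix r assume r: "r \<le> q" "puiseux_nth (puiseux_of_fps d f) r \<noteq> 0"
    from puiseux_nth_of_fps_nonzeroE[OF assms r(2)] obtain k where
      k: "r = of_nat k / of_nat d" "f $ k \<noteq> 0" .
    have "of_nat k \<le> q * of_nat d" using r(1) k(1) assms by (simp add: field_simps)
    moreover have "q * of_nat d < of_nat (subdegree f)" using f k(2) by auto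
    ultimately have "k < subdegree f" by (metis le_less_trans of_nat_less_iff)
    with k(2) show False by auto
  qed
qed

lemma ex_common_denominator:
  fixes \<gamma> :: "nat \<Rightarrow> rat"
  shows "\<exists>d>0. \<forall>i\<le>N. \<gamma> i * of_nat d \<in> \<int>"
proof -
  define B where "B = (MAX i\<in>{..N}. snd (quotient_of (\<gamma> i)))"
  have "\<gamma> i * of_nat (fact (nat B)) \<in> \<int>" if "i \<le> N" for i
    unfolding B_def using that by (intro rat_times_fact_Ints Max_ge) auto
  thus ?thesis by (intro exI[of _ "fact (nat B)"]) auto
qed

lemma puiseux_nth_sum: "puiseux_nth (sum p A) r = (\<Sum>i\<in>A. puiseux_nth (p i) r)"
  by (induction A rule: infinite_finite_induct) (simp_all add: zero_puiseux.rep_eq plus_puiseux.rep_eq)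

lemma puiseux_nth_diff:
  fixes p q :: "'a::comm_ring_1 puiseux"
  shows "puiseux_nth (p - q) r = puiseux_nth p r - puiseux_nth q r"
  unfolding minus_puiseux_def plus_puiseux.rep_eq uminus_puiseux.rep_eq by simp

lemma puiseux_nth_partial:
  "puiseux_nth (puiseux_partial a \<gamma> M) r = (\<Sum>i=0..M. if r = \<gamma> i then a i else 0)"
  by (simp add: puiseux_partial_def puiseux_nth_sum puiseux_monom.rep_eq)

text \<open>
  The terms of index above \<open>M\<close> have exponents above \<open>\<gamma> M\<close>.
\<close>

lemma puiseux_nth_partial_truncate:
  assumes "strict_mono_on {0..N} \<gamma>" "M \<le> N" "r \<le> \<gamma> M"
  shows "puiseux_nth (puiseux_partial a \<gamma> N) r = puiseux_nth (puiseux_partial a \<gamma> M) r"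
  unfolding puiseux_nth_partial
proof (rule sum.mono_neutral_right)
  show "\<forall>i\<in>{0..N} - {0..M}. (if r = \<gamma> i then a i else 0) = 0"
  proof
    fix i assume "i \<in> {0..N} - {0..M}"
    hence "\<gamma> M < \<gamma> i" using assms(1,2) by (auto simp: strict_mono_on_def)
    thus "(if r = \<gamma> i then a i else 0) = 0" using assms(3) by auto
  qed
qed (use assms(2) in auto)

text \<open>
  A finite sum of monomials with nonnegative exponents becomes a polynomial in $s$ once $d$ is a common
  denominator of the exponents.
\<close>

lemma ex_fps_puiseux_partial:
  assumes "\<And>i. i \<le> N \<Longrightarrow> \<gamma> i \<ge> 0"
  obtains d \<theta> where "d > 0" "puiseux_partial a \<gamma> N = puiseux_of_fps d \<theta>"
proof -
  obtain d where d: "d > 0" "\<And>i. i \<le> N \<Longrightarrow> \<gamma> i * of_nat d \<in> \<int>"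
    using ex_common_denominator by blast
  interpret inj_comm_ring_hom "puiseux_of_fps d :: complex fps \<Rightarrow> _"
    by (rule inj_comm_ring_hom_puiseux_of_fps[OF d(1)])
  define k where "k = (\<lambda>i. nat \<lfloor>\<gamma> i * of_nat d\<rfloor>)"
  have k: "\<gamma> i = of_nat (k i) / of_nat d" if "i \<le> N" for i
  proof -
    from d(2)[OF that] obtain j where j: "\<gamma> i * of_nat d = of_int j" by (elim Ints_cases)
    have "\<gamma> i * of_nat d \<ge> 0" using assms[OF that] by simp
    hence "j \<ge> 0" by (simp add: j)
    hence "of_nat (k i) = \<gamma> i * of_nat d" by (simp add: k_def j)
    thus ?thesis using d(1) by (simp add: field_simps)
  qed
  have "puiseux_partial a \<gamma> N = (\<Sum>i=0..N. puiseux_of_fps d (fps_const (a i) * fps_X ^ k i))"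
    unfolding puiseux_partial_def
    by (rule sum.cong) (simp_all add: puiseux_of_fps_monom[OF d(1)] k)
  also have "\<dots> = puiseux_of_fps d (\<Sum>i=0..N. fps_const (a i) * fps_X ^ k i)"
    by (simp add: hom_sum)
  finally show ?thesis using that d(1) by blast
qed

section \<open>The greatest common divisor near an approximate common zero\<close>

text \<open>
  If \<open>u\<close> and \<open>v\<close> were both divisible by a higher power of the variable than \<open>x\<close>, so would be \<open>x\<close>.
\<close>

lemma subdegree_combination:
  fixes u v :: "'a::field fps"
  assumes x: "x = a * u + b * v" and "x \<noteq> 0"
  shows "(u \<noteq> 0 \<and> subdegree u \<le> subdegree x) \<or> (v \<noteq> 0 \<and> subdegree v \<le> subdegree x)"
proof (rule ccontr)
  assume neg: "\<not> ?thesis"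
  define n where "n = Suc (subdegree x)"
  have "fps_X ^ n dvd u" using neg by (cases "u = 0") (auto simp: fps_dvd_iff n_def)
  moreover have "fps_X ^ n dvd v" using neg by (cases "v = 0") (auto simp: fps_dvd_iff n_def)
  ultimately have "fps_X ^ n dvd x" unfolding x by (intro dvd_add dvd_mult)
  thus False using \<open>x \<noteq> 0\<close> by (simp add: fps_dvd_iff n_def)
qed

text \<open>
  The gain from dividing by a common factor of bidegree \<open>(e1, e2)\<close>. Here \<open>(d1j, d2j)\<close> stands for the
  bidegree of \<open>f\<^sub>j\<close> and \<open>(k1j, k2j)\<close> for that of the cofactor \<open>h\<^sub>j\<close>. The mixed degree
  $k_{11}k_{22} + k_{12}k_{21}$ falls short of $d_{11}d_{22} + d_{12}d_{21}$ at least by the terms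
  linear in $e_1$ and $e_2$.
\<close>

lemma degree_bound_quotients:
  fixes e1 e2 :: nat
  assumes "k11 + e1 \<le> d11" "k12 + e1 \<le> d12" "d21 = k21 + e2" "d22 = k22 + e2"
  shows "k11 * k22 + k12 * k21 + e1 * (k21 + k22) + e2 * (d11 + d12) \<le> d11 * d22 + d12 * d21"
proof -
  have "(k11 + e1) * k22 + (k12 + e1) * k21 \<le> d11 * k22 + d12 * k21"
    using assms by (intro add_mono mult_right_mono) auto
  thus ?thesis using assms(3,4) by (simp add: algebra_simps)
qed

text \<open>
  Put $D = d_{11}d_{22} + d_{12}d_{21}$ and $x = L - D \ge 0$. By \<open>degree_bound_quotients\<close> the
  right-hand side is at least
  $(x + e_1 t - e_1)/e_2 + d_{11} + d_{12}$ with $t = k_{21} + k_{22}$. It remains to replace $e_1$ and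
  $e_2$ by the minima that bound them. If $t = 0$, then $e_2$ equals the minimum of $d_{21}$ and
  $d_{22}$, and only $e_1$ is changed. If $t \ge 1$, the term $e_1 t$ absorbs $e_1$, and what remains is
  $x/e_2$ with $x \ge 0$. This distinction is needed because
  $x - \min\{d_{11},d_{12}\}$ can be negative, so that its quotient by $e_2$ can increase with $e_2$.
\<close>

lemma exponent_bound:
  fixes L :: rat and e1 e2 :: nat
  assumes k: "k11 + e1 \<le> d11" "k12 + e1 \<le> d12" "d21 = k21 + e2" "d22 = k22 + e2"
    and "e2 > 0" and L: "L \<ge> of_nat (d11 * d22 + d12 * d21)"
  shows "(L - of_nat (d11 * d22 + d12 * d21) - of_nat (min d11 d12)) / of_nat (min d21 d22)
             + of_nat d11 + of_nat d12
         \<le> (L - of_nat (k11 * k22 + k12 * k21) - of_nat e1) / of_nat e2"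
proof -
  define D where "D = d11 * d22 + d12 * d21"
  define m1 m2 where "m1 = min d11 d12" and "m2 = min d21 d22"
  define x where "x = L - of_nat D"
  define t where "t = k21 + k22"
  have x: "x \<ge> 0" using L by (simp add: x_def D_def)
  have m: "e1 \<le> m1" "e2 \<le> m2" "m2 > 0" using k \<open>e2 > 0\<close> by (auto simp: m1_def m2_def)
  have "rat_of_nat (k11 * k22 + k12 * k21 + e1 * t + e2 * (d11 + d12)) \<le> of_nat D"
    unfolding D_def t_def of_nat_le_iff by (rule degree_bound_quotients[OF k])
  hence "x + of_nat e1 * of_nat t - of_nat e1 + of_nat e2 * (of_nat d11 + of_nat d12)
      \<le> L - of_nat (k11 * k22 + k12 * k21) - of_nat e1"
    by (simp add: x_def)
  hence "(x + of_nat e1 * of_nat t - of_nat e1) / of_nat e2 + of_nat d11 + of_nat d12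
      \<le> (L - of_nat (k11 * k22 + k12 * k21) - of_nat e1) / of_nat e2"
    using \<open>e2 > 0\<close> by (simp add: field_simps)
  moreover have "(x - of_nat m1) / of_nat m2 \<le> (x + of_nat e1 * of_nat t - of_nat e1) / of_nat e2"
  proof (cases "t = 0")
    case True
    hence "m2 = e2" using k by (simp add: t_def m2_def)
    thus ?thesis using True m \<open>e2 > 0\<close> by (simp add: divide_right_mono)
  next
    case False
    have "(x - of_nat m1) / of_nat m2 \<le> x / of_nat m2" by (intro divide_right_mono) auto
    also have "\<dots> \<le> x / of_nat e2" using x m \<open>e2 > 0\<close> by (intro divide_left_mono) auto
    also have "\<dots> \<le> (x + of_nat e1 * of_nat t - of_nat e1) / of_nat e2"
    proof (intro divide_right_mono)
      have "e1 * 1 \<le> e1 * t" using False by (intro mult_left_mono) auto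
      hence "rat_of_nat e1 \<le> of_nat (e1 * t)" unfolding of_nat_le_iff by simp
      thus "x \<le> x + of_nat e1 * of_nat t - of_nat e1" by simp
    qed simp
    finally show ?thesis .
  qed
  ultimately show ?thesis by (simp add: x_def D_def m1_def m2_def)
qed

text \<open>
  The theorem for power series in $s$, where \<open>\<theta>\<close> is any approximate common zero and \<open>E f\<close> is
  $f(\xi + s^d, \theta)$. The rational orders of the theorem are orders in $s$ divided by \<open>d\<close>, or by
  \<open>d * e\<close> after ramification.
\<close>

lemma common_factor_near_approximate_zero:
  fixes f1 f2 :: "complex poly poly" and \<theta> :: "complex fps" and L :: rat and d :: nat and \<xi> :: complex
  defines "E \<equiv> \<lambda>f. poly (map_poly (centred_fps \<xi> d) f) \<theta>"
  assumes d: "d > 0" and deg: "degree f1 > 0" "degree f2 > 0"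
    and nz: "\<not> (E f1 = 0 \<and> E f2 = 0)"
    and ord1: "E f1 \<noteq> 0 \<Longrightarrow> of_nat (subdegree (E f1)) > L * of_nat d"
    and ord2: "E f2 \<noteq> 0 \<Longrightarrow> of_nat (subdegree (E f2)) > L * of_nat d"
    and L: "L \<ge> of_nat (deg_X1 f1 * degree f2 + deg_X1 f2 * degree f1)"
  obtains g e \<eta> where "g dvd f1" "g dvd f2" "degree g > 0" "e > 0"
    "poly (map_poly (centred_fps \<xi> (d * e)) g) \<eta> = 0"
    "of_nat (subdegree (ramify e \<theta> - \<eta>)) >
       ((L - of_nat (deg_X1 f1 * degree f2 + deg_X1 f2 * degree f1) - of_nat (min (deg_X1 f1) (deg_X1 f2)))
           / of_nat (min (degree f1) (degree f2)) + of_nat (deg_X1 f1) + of_nat (deg_X1 f2)) * of_nat (d * e)"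
proof -
  interpret inj_idom_hom "centred_fps \<xi> d" by (rule inj_idom_hom_centred_fps[OF d])
  interpret R: map_poly_inj_idom_hom "centred_fps \<xi> d" ..
  have E_mult: "E (p * q) = E p * E q" and E_add: "E (p + q) = E p + E q" for p q
    by (simp_all add: E_def R.hom_mult R.hom_add)
  have f0: "f1 \<noteq> 0" "f2 \<noteq> 0" using deg by auto
  define g where "g = gcd f1 f2"
  have g0: "g \<noteq> 0" using f0 by (simp add: g_def)
  obtain h1 h2 where h: "f1 = h1 * g" "f2 = h2 * g" "coprime h1 h2"
    using gcd_coprime_exists[of f1 f2] g0 unfolding g_def by blast
  have h0: "h1 \<noteq> 0" "h2 \<noteq> 0" using h f0 by auto
  define D where "D = deg_X1 f1 * degree f2 + deg_X1 f2 * degree f1"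
  define D' where "D' = deg_X1 h1 * degree h2 + deg_X1 h2 * degree h1"
  have bounds: "deg_X1 h1 + deg_X1 g \<le> deg_X1 f1" "deg_X1 h2 + deg_X1 g \<le> deg_X1 f2"
      "degree f1 = degree h1 + degree g" "degree f2 = degree h2 + degree g"
    unfolding h using h0 g0 by (simp_all add: deg_X1_mult_ge degree_mult_eq)
  define X where "X = deg_X1 g * (degree h1 + degree h2)"
  define Y where "Y = degree g * (deg_X1 f1 + deg_X1 f2)"
  have D_le: "D' + X + Y \<le> D"
    unfolding D_def D'_def X_def Y_def by (rule degree_bound_quotients[OF bounds])
  \<comment> \<open>This is where the positivity of the degrees in $X_2$ enters: \<open>g\<close> has positive degree in $X_2$,
  or both cofactors have.\<close>
  have D'_le: "D' + deg_X1 g \<le> D"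
  proof (cases "degree g = 0")
    case True
    hence "deg_X1 g * 1 \<le> X"
      unfolding X_def using bounds deg by (intro mult_left_mono) auto
    thus ?thesis using D_le by linarith
  next
    case False
    hence "1 * (deg_X1 f1 + deg_X1 f2) \<le> Y"
      unfolding Y_def by (intro mult_right_mono) auto
    hence "deg_X1 g \<le> Y" using bounds(1) by simp
    thus ?thesis using D_le by linarith
  qed

  obtain r A B where r: "r \<noteq> 0" "degree r \<le> D'" "[:r:] = A * h1 + B * h2"
    using coprime_imp_eliminant[OF h(3)] unfolding D'_def by blast
  have "E [:r:] = centred_fps \<xi> d r" by (simp add: E_def map_poly_pCons_hom)
  moreover have "E [:r:] = E A * E h1 + E B * E h2" by (simp add: r(3) E_mult E_add)
  ultimately have comb: "centred_fps \<xi> d r = E A * E h1 + E B * E h2" by simp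
  have r_nz: "centred_fps \<xi> d r \<noteq> 0" using r(1) by simp
  have "d * degree r \<le> d * D'" using r(2) by simp
  hence r_le: "subdegree (centred_fps \<xi> d r) \<le> d * D'"
    using subdegree_centred_fps_le[OF d r(1), of \<xi>] by linarith
  \<comment> \<open>If $g(t,\theta) = 0$, then both $f_j(t,\theta)$ would vanish.\<close>
  have Eg: "E g \<noteq> 0" using nz by (auto simp: h E_mult)
  have ord_g: "of_nat (subdegree (E g)) > (L - of_nat D') * of_nat d"
  proof -
    have aux: ?thesis if h': "E h' \<noteq> 0" "subdegree (E h') \<le> d * D'"
      and f': "E (h' * g) \<noteq> 0 \<Longrightarrow> of_nat (subdegree (E (h' * g))) > L * of_nat d" for h'
    proof -
      have "of_nat (subdegree (E h') + subdegree (E g)) > L * of_nat d"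
        using f' h'(1) Eg by (simp add: E_mult)
      moreover have "rat_of_nat (subdegree (E h')) \<le> of_nat (d * D')"
        using h'(2) by (simp only: of_nat_le_iff)
      ultimately show ?thesis by (simp add: algebra_simps)
    qed
    from subdegree_combination[OF comb r_nz] show ?thesis
    proof
      assume "E h1 \<noteq> 0 \<and> subdegree (E h1) \<le> subdegree (centred_fps \<xi> d r)"
      with r_le ord1 show ?thesis by (intro aux[of h1, folded h(1)]) auto
    next
      assume "E h2 \<noteq> 0 \<and> subdegree (E h2) \<le> subdegree (centred_fps \<xi> d r)"
      with r_le ord2 show ?thesis by (intro aux[of h2, folded h(2)]) auto
    qed
  qed
  have "rat_of_nat (D' + deg_X1 g) \<le> of_nat D" unfolding of_nat_le_iff by (rule D'_le)
  hence "of_nat (deg_X1 g) \<le> L - of_nat D'" using L by (simp add: D_def)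
  hence "of_nat (deg_X1 g) * of_nat d \<le> (L - of_nat D') * of_nat d"
    by (rule mult_right_mono) simp
  with ord_g have "rat_of_nat (deg_X1 g * d) < of_nat (subdegree (E g))" by simp
  hence ord_g': "deg_X1 g * d < subdegree (E g)" by (simp only: of_nat_less_iff)

  define G where "G = map_poly (centred_fps \<xi> d) g"
  have G: "poly G \<theta> = E g" "degree G = degree g" "lead_coeff G = centred_fps \<xi> d (lead_coeff g)"
    by (simp_all add: G_def E_def)
  have "subdegree (lead_coeff G) \<le> d * degree (lead_coeff g)"
    unfolding G(3) using g0 by (intro subdegree_centred_fps_le[OF d]) simp
  also have "\<dots> \<le> deg_X1 g * d" by (simp add: degree_coeff_le_deg_X1)
  finally have lc: "subdegree (lead_coeff G) \<le> deg_X1 g * d" .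
  \<comment> \<open>Otherwise \<open>g\<close> is its own leading coefficient, whose order is too small.\<close>
  have deg_g: "degree g > 0"
  proof (rule ccontr)
    assume "\<not> degree g > 0"
    then obtain c where c: "G = [:c:]" using G(2) by (metis degree_eq_zeroE gr0I)
    have "subdegree (E g) = subdegree (lead_coeff G)" by (simp add: c flip: G(1))
    with lc ord_g' show False by simp
  qed
  have "degree G > 0" "poly G \<theta> \<noteq> 0" "subdegree (lead_coeff G) \<le> subdegree (poly G \<theta>)"
    using deg_g Eg lc ord_g' by (simp_all add: G)
  then obtain e \<eta> where e: "e > 0" and root: "poly (map_poly (ramify e) G) \<eta> = 0"
    and near: "e * subdegree (E g) \<le> degree g * subdegree (ramify e \<theta> - \<eta>) + e * subdegree (lead_coeff G)"
    by (rule puiseux_root_near) (simp only: G)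
  have near': "e * subdegree (E g) \<le> degree g * subdegree (ramify e \<theta> - \<eta>) + e * (deg_X1 g * d)"
    using near mult_le_mono2[OF lc, of e] by linarith
  let ?s = "rat_of_nat (subdegree (ramify e \<theta> - \<eta>))"
  have "of_nat e * rat_of_nat (subdegree (E g)) \<le>
      of_nat (degree g) * ?s + of_nat e * (of_nat (deg_X1 g) * of_nat d)"
    using near' unfolding of_nat_mult[symmetric] of_nat_add[symmetric] of_nat_le_iff .
  moreover have "of_nat e * ((L - of_nat D') * of_nat d) < of_nat e * rat_of_nat (subdegree (E g))"
    using ord_g e by (intro mult_strict_left_mono) auto
  ultimately have "of_nat e * ((L - of_nat D') * of_nat d) <
      of_nat (degree g) * ?s + of_nat e * (of_nat (deg_X1 g) * of_nat d)" by linarith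
  hence "(L - of_nat D' - of_nat (deg_X1 g)) * of_nat (d * e) < of_nat (degree g) * ?s"
    by (simp add: algebra_simps)
  hence s: "(L - of_nat D' - of_nat (deg_X1 g)) / of_nat (degree g) * of_nat (d * e) < ?s"
    using deg_g by (simp add: field_simps)
  show ?thesis
  proof (rule that[of g e \<eta>])
    show "g dvd f1" "g dvd f2" by (simp_all add: g_def)
    have "map_poly (ramify e) G = map_poly (centred_fps \<xi> (d * e)) g"
      using ramify_centred_fps[OF d e, of \<xi>] unfolding G_def
      by (subst map_poly_map_poly) (simp_all add: ramify_def o_def)
    with root show "poly (map_poly (centred_fps \<xi> (d * e)) g) \<eta> = 0" by simp
    have "((L - of_nat (deg_X1 f1 * degree f2 + deg_X1 f2 * degree f1) - of_nat (min (deg_X1 f1) (deg_X1 f2)))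
           / of_nat (min (degree f1) (degree f2)) + of_nat (deg_X1 f1) + of_nat (deg_X1 f2)) * rat_of_nat (d * e)
        \<le> (L - of_nat D' - of_nat (deg_X1 g)) / of_nat (degree g) * of_nat (d * e)"
      unfolding D'_def by (intro mult_right_mono exponent_bound[OF bounds deg_g L]) simp
    also note s
    finally show "?s >
       ((L - of_nat (deg_X1 f1 * degree f2 + deg_X1 f2 * degree f1) - of_nat (min (deg_X1 f1) (deg_X1 f2)))
           / of_nat (min (degree f1) (degree f2)) + of_nat (deg_X1 f1) + of_nat (deg_X1 f2)) * of_nat (d * e)" .
  qed (use deg_g e in auto)
qed

section \<open>Curves of common zeroes\<close>

theorem proposition3:
  fixes f1 f2 :: "complex poly poly"
    and \<xi> :: "complex \<times> complex"
    and N :: nat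
    and a :: "nat \<Rightarrow> complex"
    and \<gamma> :: "nat \<Rightarrow> rat"
    and L :: rat
    and \<theta> :: "complex puiseux"
    and d11 d12 d21 d22 M :: nat
  assumes "deg_X2 f1 > 0" and "deg_X2 f2 > 0"
    and "\<xi> \<in> zero_locus f1 \<inter> zero_locus f2"
    and "\<theta> = puiseux_partial a \<gamma> N"
    and "a 0 = snd \<xi>"
    and "\<gamma> 0 = 0" and "strict_mono_on {0..N} \<gamma>" and "\<gamma> N \<le> L"
    and "puiseux_ord (puiseux_subst f1 (fst \<xi>) \<theta>) > Fin L"
    and "puiseux_ord (puiseux_subst f2 (fst \<xi>) \<theta>) > Fin L"
    and "\<not> (puiseux_subst f1 (fst \<xi>) \<theta> = 0 \<and> puiseux_subst f2 (fst \<xi>) \<theta> = 0)"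
    and "d11 = deg_X1 f1" and "d12 = deg_X1 f2"
    and "d21 = deg_X2 f1" and "d22 = deg_X2 f2"
    and "L \<ge> of_nat (d11 * d22 + d12 * d21)"
    and "M = Max {i \<in> {0..N}. \<gamma> i \<le>
           (L - of_nat (d11 * d22 + d12 * d21) - of_nat (min d11 d12)) / of_nat (min d21 d22)
             + of_nat d11 + of_nat d12}"
  shows "\<exists>q. nonconstant q \<and> \<xi> \<in> zero_locus q \<and> zero_locus q \<subseteq> zero_locus f1 \<inter> zero_locus f2 \<and>
           (\<exists>\<eta>. parametrizes \<eta> q \<xi> \<and> has_initial_terms \<eta> a \<gamma> M)"
proof -
  define \<beta> where "\<beta> = (L - of_nat (d11 * d22 + d12 * d21) - of_nat (min d11 d12)) / of_nat (min d21 d22)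
             + of_nat d11 + of_nat d12"
  have \<gamma>_pos: "\<gamma> i > 0" if "0 < i" "i \<le> N" for i
    using strict_mono_onD[OF assms(7), of 0 i] that assms(6) by simp
  have \<gamma>_nonneg: "\<gamma> i \<ge> 0" if "i \<le> N" for i
    using \<gamma>_pos[of i] that assms(6) by (cases "i = 0") auto
  \<comment> \<open>This makes 0 a member of the set whose maximum is \<open>M\<close>.\<close>
  have \<beta>_nonneg: "\<beta> \<ge> 0"
  proof -
    define m1 m2 where "m1 = min d11 d12" and "m2 = min d21 d22"
    have "m2 \<ge> 1" using assms(1,2,14,15) by (simp add: m2_def)
    have "- rat_of_nat m1 = - of_nat m1 / 1" by simp
    also have "\<dots> \<le> - of_nat m1 / of_nat m2"
      using \<open>m2 \<ge> 1\<close> by (simp add: field_simps mult_le_cancel_left1)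
    also have "\<dots> \<le> (L - of_nat (d11 * d22 + d12 * d21) - of_nat m1) / of_nat m2"
      using assms(16) by (intro divide_right_mono) auto
    finally have "- rat_of_nat m1 \<le> (L - of_nat (d11 * d22 + d12 * d21) - of_nat m1) / of_nat m2" .
    moreover have "rat_of_nat m1 \<le> of_nat d11" unfolding of_nat_le_iff by (simp add: m1_def)
    moreover have "0 \<le> q + y + z" if "- x \<le> q" "x \<le> y" "0 \<le> z" for x y z q :: rat
      using that by linarith
    ultimately show ?thesis
      unfolding \<beta>_def m1_def[symmetric] m2_def[symmetric] using of_nat_0_le_iff by blast
  qed
  have "M \<in> {i \<in> {0..N}. \<gamma> i \<le> \<beta>}"
    unfolding assms(17) \<beta>_def[symmetric]
  proof (rule Max_in)
    have "0 \<in> {i \<in> {0..N}. \<gamma> i \<le> \<beta>}" using \<beta>_nonneg assms(6) by simp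
    thus "{i \<in> {0..N}. \<gamma> i \<le> \<beta>} \<noteq> {}" by blast
  qed simp
  hence M: "M \<le> N" "\<gamma> M \<le> \<beta>" by auto

  obtain d t where d: "d > 0" and t: "\<theta> = puiseux_of_fps d t"
    using ex_fps_puiseux_partial[of N \<gamma> a] \<gamma>_nonneg assms(4) by metis
  interpret inj_comm_ring_hom "puiseux_of_fps d :: complex fps \<Rightarrow> _"
    by (rule inj_comm_ring_hom_puiseux_of_fps[OF d])
  note subst = puiseux_subst_of_fps[OF d, of _ "fst \<xi>" t, folded t]
  have nz: "\<not> (poly (map_poly (centred_fps (fst \<xi>) d) f1) t = 0 \<and> poly (map_poly (centred_fps (fst \<xi>) d) f2) t = 0)"
    using assms(11) by (simp add: subst)
  note ord1 = assms(9)[unfolded subst puiseux_ord_of_fps_greater_iff[OF d], rule_format]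
  note ord2 = assms(10)[unfolded subst puiseux_ord_of_fps_greater_iff[OF d], rule_format]
  obtain g e \<eta> where g: "g dvd f1" "g dvd f2" "degree g > 0" and e: "e > 0"
    and root: "poly (map_poly (centred_fps (fst \<xi>) (d * e)) g) \<eta> = 0"
    and near: "of_nat (subdegree (ramify e t - \<eta>)) > \<beta> * of_nat (d * e)"
    using common_factor_near_approximate_zero[OF d assms(1,2) nz ord1 ord2
        assms(16)[unfolded assms(12-15)]]
    unfolding \<beta>_def assms(12-15) by blast
  have de: "d * e > 0" using d e by simp
  interpret de: inj_comm_ring_hom "puiseux_of_fps (d * e) :: complex fps \<Rightarrow> _"
    by (rule inj_comm_ring_hom_puiseux_of_fps[OF de])
  define \<zeta> where "\<zeta> = puiseux_of_fps (d * e) \<eta>"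
  have "puiseux_ord (puiseux_of_fps (d * e) (ramify e t - \<eta>)) > Fin \<beta>"
    using near unfolding puiseux_ord_of_fps_greater_iff[OF de] by blast
  hence "puiseux_ord (\<theta> - \<zeta>) > Fin \<beta>"
    by (simp add: de.hom_minus puiseux_of_fps_ramify[OF d e] \<zeta>_def t)
  hence \<zeta>_nth: "puiseux_nth \<zeta> r = puiseux_nth (puiseux_partial a \<gamma> M) r" if "r \<le> \<gamma> M" for r
    using that M puiseux_nth_partial_truncate[OF assms(7) M(1) that, of a]
    by (simp add: puiseux_ord_greater_iff puiseux_nth_diff assms(4))
  have partial_nonpos: "puiseux_nth (puiseux_partial a \<gamma> M) r = puiseux_nth (puiseux_const (snd \<xi>)) r"
    if "r \<le> 0" for r
  proof -
    have "puiseux_nth (puiseux_partial a \<gamma> M) r = puiseux_nth (puiseux_partial a \<gamma> 0) r"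
      using assms(6,7) M(1) that
      by (intro puiseux_nth_partial_truncate) (auto simp: strict_mono_on_def)
    thus ?thesis by (simp add: puiseux_nth_partial puiseux_monom.rep_eq assms(5,6))
  qed
  have \<zeta>_nonpos: "puiseux_nth \<zeta> r = puiseux_nth (puiseux_const (snd \<xi>)) r" if "r \<le> 0" for r
    using \<zeta>_nth[of r] partial_nonpos[OF that] \<gamma>_nonneg[OF M(1)] that by simp
  have "puiseux_subst g (fst \<xi>) \<zeta> = 0"
    unfolding \<zeta>_def puiseux_subst_of_fps[OF de] root by (rule de.hom_zero)
  hence "parametrizes \<zeta> g \<xi>"
    unfolding parametrizes_def using \<zeta>_nonpos by (auto simp: puiseux_nth_diff not_le[symmetric])
  moreover have "has_initial_terms \<zeta> a \<gamma> M"
    unfolding has_initial_terms_def puiseux_ord_greater_iff by (simp add: puiseux_nth_diff \<zeta>_nth)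
  moreover have "\<xi> \<in> zero_locus g"
  proof -
    have "\<eta> $ 0 = snd \<xi>"
      using puiseux_nth_of_fps[OF de, of \<eta> 0] \<zeta>_nonpos[of 0] by (simp add: \<zeta>_def puiseux_monom.rep_eq)
    with root_at_centre[OF de root] show ?thesis by (simp add: zero_locus_def case_prod_beta)
  qed
  moreover have "nonconstant g" using g(3) by (simp add: nonconstant_def)
  moreover have "zero_locus g \<subseteq> zero_locus f1 \<inter> zero_locus f2"
    using zero_locus_dvd g(1,2) by blast
  ultimately show ?thesis by blast
qed

end
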